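(* Let $\xi$ be a countable ordinal. Suppose that $A\subseteq\omega^\omega$ is $\mathbf\Sigma^0_{1+\xi}$ and that $B_0,B_1\subseteq\omega^\omega$ are disjoint $\mathbf\Sigma^1_1$ sets. Then at least one of the following holds: (1) there is a continuous function $f\colon\omega^\omega\to\omega^\omega$ such that $A=f^{-1}(B_1)$ and $\omega^\omega\setminus A=f^{-1}(B_0)$; (2) there is a $\mathbf\Sigma^0_{1+\xi}$ set $U\subseteq\omega^\omega$ with $B_0\subseteq U$ and $B_1\cap U=\emptyset$.
   Context: $\mathbf\Sigma^0_{1+\xi}$ denotes the usual boldface Borel class of subsets of Baire space $\omega^\omega$ (so $\xi=0$ gives the open sets), and $\mathbf\Sigma^1_1$ denotes the analytic subsets of $\omega^\omega$. *)

theory Defs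
  imports "HOL-Analysis.Analysis"
begin

text \<open>
  Baire space with the product topology of the discrete topology on \<open>nat\<close>,
  which is its type class topology.
\<close>

type_synonym baire = "nat \<Rightarrow> nat"

text \<open>
  Countable ordinals are represented by (reflexive) well-orders \<open>\<xi> :: nat rel\<close> on arbitrary
  subsets of \<open>nat\<close>, compared by \<open>ordLess\<close>; every countable ordinal is the order type of
  such a relation, and \<open>{}\<close> represents \<open>0\<close>.

  \<open>Sigma0_one_plus \<xi>\<close> is the boldface class \<open>\<Sigma>\<^sup>0\<close> of index \<open>1 + \<xi>\<close>.  For \<open>\<alpha> > 1\<close>
  the sets of class \<open>\<alpha>\<close> are the countable unions of complements of sets of classes \<open>\<beta>\<close>
  with \<open>1 \<le> \<beta> < \<alpha>\<close>.  If \<open>\<alpha> = 1 + \<xi>\<close>, these \<open>\<beta>\<close> are exactly the ordinals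
  \<open>1 + \<eta>\<close> with \<open>\<eta> < \<xi>\<close>, at infinite levels as well.  The union rule does not apply
  to \<open>\<xi> = {}\<close>, which has no predecessors.
\<close>

inductive Sigma0_one_plus :: "nat rel \<Rightarrow> baire set \<Rightarrow> bool" where
  open_sets: "open A \<Longrightarrow> Sigma0_one_plus {} A"
| countable_union:
    "(\<And>n. (\<eta> n, \<xi>) \<in> ordLess) \<Longrightarrow> (\<And>n. Sigma0_one_plus (\<eta> n) (- B n)) \<Longrightarrow>
      Sigma0_one_plus \<xi> (\<Union>n::nat. B n)"

text \<open>The class \<open>\<Sigma>\<^sup>1\<^sub>1\<close>: projections of closed subsets of the square of Baire space.\<close>

definition Sigma11 :: "baire set \<Rightarrow> bool" where
  "Sigma11 B \<longleftrightarrow> (\<exists>C :: (baire \<times> baire) set. closed C \<and> B = {x. \<exists>y. (x, y) \<in> C})"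

end

theory Submission
  imports Defs
begin

text \<open>
  Write \<open>A\<close> through a countable well-founded family of sets, each open or a union of complements
  of sets of smaller rank.  Reading \<open>x\<close> one digit at a time, one guesses the memberships of \<open>x\<close>
  in these sets; for every rank the stages whose guesses up to that rank persist form a tree
  order, and every \<open>x\<close> has infinitely many stages all of whose guesses are true.

  Suppose \<open>B\<^sub>0\<close> and \<open>B\<^sub>1\<close> are the projections of the closed sets \<open>C\<^sub>0\<close> and \<open>C\<^sub>1\<close> and cannot be separated.
  To each finite string attach a piece of \<open>C\<^sub>0\<close> or \<open>C\<^sub>1\<close>, according to the current guess about
  \<open>x \<in> A\<close>, contained in the piece of the preceding stage with the same guess of \<open>A\<close>, together with a
  \<open>\<sigma>\<close>-ideal not containing it.  The ideals express that the piece cannot be separated, by sets of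
  the appropriate classes, from the pieces to which one must return if a guess turns out wrong;
  inseparability of \<open>B\<^sub>0\<close> and \<open>B\<^sub>1\<close> starts the construction, and \<open>\<sigma>\<close>-ideals allow each piece to be
  replaced by one of small diameter.  Along the true stages of \<open>x\<close> the pieces decrease to a
  point, whose first coordinate is the value of the reduction.
\<close>

section \<open>Strings and cylinders\<close>

definition cyl :: "nat list \<Rightarrow> baire set" where
  "cyl \<sigma> = {x. \<forall>i<length \<sigma>. x i = \<sigma> ! i}"

definition pre :: "baire \<Rightarrow> nat \<Rightarrow> nat list" where
  "pre x n = map x [0..<n]"

lemma length_pre [simp]: "length (pre x n) = n"
  by (simp add: pre_def)

lemma pre_nth [simp]: "i < n \<Longrightarrow> pre x n ! i = x i"
  by (simp add: pre_def)

lemma take_pre [simp]: "r \<le> n \<Longrightarrow> take r (pre x n) = pre x r"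
  by (rule nth_equalityI) auto

lemma mem_cyl_pre: "y \<in> cyl (pre x n) \<longleftrightarrow> (\<forall>i<n. y i = x i)"
  by (simp add: cyl_def)

lemma pre_eq_iff: "pre x n = pre y n \<longleftrightarrow> (\<forall>i<n. x i = y i)"
  by (auto simp: list_eq_iff_nth_eq)

lemma pre_0 [simp]: "pre x 0 = []"
  by (simp add: pre_def)

lemma pre_eq_Nil [simp]: "pre x n = [] \<longleftrightarrow> n = 0"
  by (simp add: pre_def)

lemma open_cyl: "open (cyl \<sigma>)"
proof -
  have "cyl \<sigma> = (\<Inter>i\<in>{..<length \<sigma>}. {x. x i \<in> {\<sigma> ! i}})"
    by (auto simp: cyl_def)
  moreover have "open {x::baire. x i \<in> {\<sigma> ! i}}" for i
    using open_vimage[of "{\<sigma> ! i}" "\<lambda>x::baire. x i"]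
    by (simp add: vimage_def open_discrete continuous_on_product_coordinates)
  ultimately show ?thesis by (auto intro: open_INT)
qed

lemma closed_cyl: "closed (cyl \<sigma>)"
proof -
  have "cyl \<sigma> = (\<Inter>i\<in>{..<length \<sigma>}. {x. x i = \<sigma> ! i})"
    by (auto simp: cyl_def)
  then show ?thesis
    by (auto intro!: closed_Collect_eq continuous_on_product_coordinates)
qed

lemma open_contains_cyl:
  fixes V :: "baire set"
  assumes "open V" "x \<in> V"
  shows "\<exists>n. cyl (pre x n) \<subseteq> V"
proof -
  have "openin (product_topology (\<lambda>i::nat. euclidean) UNIV) V"
    using assms(1) by (simp add: open_fun_def)
  then obtain X where X: "x \<in> (\<Pi>\<^sub>E i\<in>UNIV. X i)" "finite {i. X i \<noteq> topspace euclidean}"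
      "(\<Pi>\<^sub>E i\<in>UNIV. X i) \<subseteq> V"
    using product_topology_open_contains_basis[OF _ assms(2)] by blast
  have "finite {i. X i \<noteq> UNIV}" using X(2) by simp
  then obtain n where n: "\<forall>i. X i \<noteq> UNIV \<longrightarrow> i < n"
    by (meson finite_nat_set_iff_bounded mem_Collect_eq)
  have "cyl (pre x n) \<subseteq> (\<Pi>\<^sub>E i\<in>UNIV. X i)"
  proof
    fix y assume y: "y \<in> cyl (pre x n)"
    have "y i \<in> X i" for i
      using X(1) n y by (cases "i < n") (auto simp: mem_cyl_pre PiE_def Pi_def)
    then show "y \<in> (\<Pi>\<^sub>E i\<in>UNIV. X i)" by (auto simp: PiE_def)
  qed
  then show ?thesis using X(3) by blast
qed

lemma cyl_pre_antimono: "m \<le> n \<Longrightarrow> cyl (pre x n) \<subseteq> cyl (pre x m)"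
  by (auto simp: mem_cyl_pre)

section \<open>Guesses and true stages\<close>

text \<open>A Borel code spread over all natural numbers. Open nodes are leaves: \<open>rk\<close>
  and \<open>ch\<close> are unconstrained there, so \<open>node_family_exists\<close> may pad with
  copies.\<close>

locale node_family =
  fixes nset :: "nat \<Rightarrow> baire set" and rk :: "nat \<Rightarrow> 'r::wellorder" and ch :: "nat \<Rightarrow> nat set"
  assumes node: "open (nset w) \<or> (nset w = (\<Union>v\<in>ch w. - nset v) \<and> (\<forall>v\<in>ch w. rk v < rk w))"
begin

text \<open>
  \<open>yes \<sigma> w\<close> is the guess whether the branch being read lies in \<open>nset w\<close>, and \<open>cnt \<sigma> \<theta>\<close> counts the
  earlier stages agreeing with \<open>\<sigma>\<close> on ranks up to \<open>\<theta>\<close>.  Only the guesses about the nodes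
  \<open>w < cnt \<sigma> (rk w)\<close> are protected: a later stage differing from \<open>\<sigma>\<close> on one of them does not
  extend \<open>\<sigma>\<close> in the order \<open>stage_le\<close>.  As finitely many guesses are protected, and more of
  them further up a chain, true stages keep occurring; a yes guess of a true stage is
  reliable because it rests on a protected no guess.
\<close>

context notes conj_cong [fundef_cong] imp_cong [fundef_cong] begin

function yes :: "nat list \<Rightarrow> nat \<Rightarrow> bool" and cnt :: "nat list \<Rightarrow> 'r \<Rightarrow> nat" where
  "yes \<sigma> w = (if open (nset w) then \<sigma> \<noteq> [] \<and> cyl \<sigma> \<subseteq> nset w
     else (\<exists>v\<in>ch w. v < cnt \<sigma> (rk v) \<and> \<not> yes \<sigma> v))"
| "cnt \<sigma> \<theta> = card {r. r < length \<sigma> \<and>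
     (\<forall>u. rk u \<le> \<theta> \<longrightarrow> u < cnt (take r \<sigma>) (rk u) \<longrightarrow> yes (take r \<sigma>) u = yes \<sigma> u)}"
  by pat_completeness auto
termination
\<comment> \<open>The last component puts \<open>yes\<close> below \<open>cnt\<close> at equal
  string and rank, since \<open>cnt \<sigma> \<theta>\<close> consults \<open>yes \<sigma> u\<close>
  also for nodes of rank \<theta> itself.\<close>
proof (relation "inv_image (less_than <*lex*> {(a, b). a < b} <*lex*> less_than)
   (\<lambda>z. case z of Inl (\<sigma>, w) \<Rightarrow> (length \<sigma>, rk w, 0) | Inr (\<sigma>, \<theta>) \<Rightarrow> (length \<sigma>, \<theta>, 1::nat))", goal_cases)
  case 1 show ?case by (intro wf_inv_image wf_lex_prod wf_less_than wf)
next
  case (3 \<sigma> w v)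
  then show ?case using node[of w] by auto
next
  case (2 \<sigma> w v)
  then show ?case using node[of w] by auto
qed (auto simp: less_le)

end

declare yes.simps [simp del] cnt.simps [simp del]

section \<open>The order of stages along a branch\<close>

definition stage_le :: "baire \<Rightarrow> 'r set \<Rightarrow> nat \<Rightarrow> nat \<Rightarrow> bool" where
  "stage_le x D s t \<longleftrightarrow> s \<le> t \<and> (\<forall>w. rk w \<in> D \<longrightarrow> w < cnt (pre x s) (rk w) \<longrightarrow>
     yes (pre x s) w = yes (pre x t) w)"

lemma yes_open: "open (nset w) \<Longrightarrow> yes \<sigma> w \<longleftrightarrow> \<sigma> \<noteq> [] \<and> cyl \<sigma> \<subseteq> nset w"
  by (subst yes.simps) simp

lemma yes_not_open:
  "\<not> open (nset w) \<Longrightarrow> yes \<sigma> w \<longleftrightarrow> (\<exists>v\<in>ch w. v < cnt \<sigma> (rk v) \<and> \<not> yes \<sigma> v)"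
  by (subst yes.simps) simp

lemma cnt_pre: "cnt (pre x t) \<theta> = card {r. r < t \<and> stage_le x {..\<theta>} r t}"
  unfolding cnt.simps[of "pre x t"] stage_le_def
  by (rule arg_cong[where f = card]) (auto cong: conj_cong)

lemma stage_le_refl [simp]: "stage_le x D t t" by (simp add: stage_le_def)

lemma stage_le_imp_le: "stage_le x D s t \<Longrightarrow> s \<le> t" by (simp add: stage_le_def)

lemma stage_le_subset: "stage_le x D s t \<Longrightarrow> D' \<subseteq> D \<Longrightarrow> stage_le x D' s t" by (auto simp: stage_le_def)

text \<open>Every stage \<open>r\<close> counted at \<open>s\<close> is counted at \<open>t\<close>.
  A guess protected at \<open>r\<close> must be protected at \<open>s\<close> too before it carries
  over to \<open>t\<close>; that is the induction hypothesis for \<open>r < s\<close>.\<close>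

lemma cnt_mono: "stage_le x {..\<theta>} s t \<Longrightarrow> cnt (pre x s) \<theta> \<le> cnt (pre x t) \<theta>"
proof (induction s arbitrary: t \<theta> rule: less_induct)
  case (less s)
  have "stage_le x {..\<theta>} r t" if r: "r < s" "stage_le x {..\<theta>} r s" for r
    unfolding stage_le_def
  proof (intro conjI allI impI)
    show "r \<le> t" using r less.prems by (auto dest: stage_le_imp_le)
    fix w assume w: "rk w \<in> {..\<theta>}" "w < cnt (pre x r) (rk w)"
    then have "stage_le x {..rk w} r s" using r(2) by (auto intro: stage_le_subset)
    then have "w < cnt (pre x s) (rk w)" using less.IH[OF r(1)] w(2) by fastforce
    then show "yes (pre x r) w = yes (pre x t) w"
      using r(2) less.prems w by (auto simp: stage_le_def)
  qed
  then show ?case unfolding cnt_pre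
    using stage_le_imp_le[OF less.prems] by (intro card_mono) auto
qed

lemma stage_le_trans:
  assumes "stage_le x D r s" "stage_le x D s t" and D: "\<And>\<theta> \<zeta>. \<theta> \<in> D \<Longrightarrow> \<zeta> \<le> \<theta> \<Longrightarrow> \<zeta> \<in> D"
  shows "stage_le x D r t"
  unfolding stage_le_def
proof (intro conjI allI impI)
  show "r \<le> t" using stage_le_imp_le[OF assms(1)] stage_le_imp_le[OF assms(2)] by simp
  fix w assume w: "rk w \<in> D" "w < cnt (pre x r) (rk w)"
  have "{..rk w} \<subseteq> D" using D w(1) by auto
  then have "w < cnt (pre x s) (rk w)" using cnt_mono[OF stage_le_subset[OF assms(1)]] w(2) by fastforce
  then show "yes (pre x r) w = yes (pre x t) w" using assms w by (auto simp: stage_le_def)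
qed

lemma stage_le_trans_atMost: "stage_le x {..\<theta>} r s \<Longrightarrow> stage_le x {..\<theta>} s t \<Longrightarrow> stage_le x {..\<theta>} r t"
  by (rule stage_le_trans) auto

text \<open>A yes guess rests on finite evidence: a cylinder inside an open set, or a protected no
  guess of smaller rank. Both survive from \<open>s\<close> to \<open>t\<close>.\<close>

lemma yes_mono:
  assumes "stage_le x {..<rk w} s t" "yes (pre x s) w"
  shows "yes (pre x t) w"
proof (cases "open (nset w)")
  case True
  have "s \<le> t" "s > 0" using assms by (auto simp: yes_open[OF True] dest: stage_le_imp_le)
  then show ?thesis using assms(2) cyl_pre_antimono[of s t x]
    by (auto simp: yes_open[OF True])
next
  case False
  then obtain v where v: "v \<in> ch w" "v < cnt (pre x s) (rk v)" "\<not> yes (pre x s) v"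
    using assms(2) by (auto simp: yes_not_open[OF False])
  have "rk v < rk w" using node[of w] False v(1) by auto
  then have "stage_le x {..rk v} s t" using assms(1) by (auto intro: stage_le_subset)
  then have "v < cnt (pre x t) (rk v)" using cnt_mono v(2) by fastforce
  moreover have "\<not> yes (pre x t) v" using assms(1) v \<open>rk v < rk w\<close> by (auto simp: stage_le_def)
  ultimately show ?thesis using False v(1) by (auto simp: yes_not_open[OF False])
qed

text \<open>By induction on the rank, \<open>yes_mono\<close> squeezes the guess at \<open>s\<close>
  between those at \<open>r\<close> and \<open>t\<close>, which coincide for nodes protected at
  \<open>r\<close>.\<close>

lemma stage_le_interpolate:
  assumes "stage_le x D r t" "r \<le> s" and s: "\<And>\<theta>. \<theta> \<in> D \<Longrightarrow> stage_le x {..<\<theta>} s t"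
    and D: "\<And>\<theta> \<zeta>. \<theta> \<in> D \<Longrightarrow> \<zeta> \<le> \<theta> \<Longrightarrow> \<zeta> \<in> D"
  shows "stage_le x D r s"
proof -
  have "\<forall>w. rk w = \<theta> \<longrightarrow> w < cnt (pre x r) (rk w) \<longrightarrow> yes (pre x r) w = yes (pre x s) w"
    if "\<theta> \<in> D" for \<theta>
    using that
  proof (induction \<theta> rule: less_induct)
    case (less \<theta>)
    have rs: "stage_le x {..<\<theta>} r s"
      unfolding stage_le_def using assms(2) less.IH D[OF less.prems] by auto
    show ?case
    proof (intro allI impI)
      fix w assume w: "rk w = \<theta>" "w < cnt (pre x r) (rk w)"
      then have "yes (pre x r) w = yes (pre x t) w" using assms(1) less.prems by (simp add: stage_le_def)
      then show "yes (pre x r) w = yes (pre x s) w"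
        using yes_mono[of x w r s] yes_mono[of x w s t] rs s[OF less.prems] w(1) by blast
    qed
  qed
  then show ?thesis using assms(2) by (auto simp: stage_le_def)
qed

section \<open>True stages\<close>

definition true_stage :: "baire \<Rightarrow> 'r set \<Rightarrow> nat \<Rightarrow> bool" where
  "true_stage x D s \<longleftrightarrow> (\<forall>w. rk w \<in> D \<longrightarrow> w < cnt (pre x s) (rk w) \<longrightarrow>
     (yes (pre x s) w \<longleftrightarrow> x \<in> nset w))"

lemma true_stage_subset: "true_stage x D s \<Longrightarrow> D' \<subseteq> D \<Longrightarrow> true_stage x D' s" by (auto simp: true_stage_def)

lemma yes_true_stage:
  assumes "true_stage x {..<rk w} s" "yes (pre x s) w"
  shows "x \<in> nset w"
proof (cases "open (nset w)")
  case True
  then show ?thesis using assms(2) by (simp add: yes_open[OF True] subset_iff mem_cyl_pre)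
next
  case False
  then obtain v where v: "v \<in> ch w" "v < cnt (pre x s) (rk v)" "\<not> yes (pre x s) v"
    using assms(2) by (auto simp: yes_not_open[OF False])
  then have "x \<notin> nset v" using node[of w] False assms(1) by (auto simp: true_stage_def)
  then show ?thesis using node[of w] False v(1) by auto
qed

text \<open>The squeeze of \<open>stage_le_interpolate\<close> with the truth as upper end: a yes
  guess at \<open>s\<close> persists at \<open>t\<close>, and a yes guess at \<open>t\<close> is
  right.\<close>

lemma true_stage_imp_le:
  assumes "true_stage x D s" "true_stage x D t" "s \<le> t"
    and D: "\<And>\<theta> \<zeta>. \<theta> \<in> D \<Longrightarrow> \<zeta> \<le> \<theta> \<Longrightarrow> \<zeta> \<in> D"
  shows "stage_le x D s t"
proof -
  have "\<forall>w. rk w = \<theta> \<longrightarrow> w < cnt (pre x s) (rk w) \<longrightarrow> yes (pre x s) w = yes (pre x t) w"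
    if "\<theta> \<in> D" for \<theta>
    using that
  proof (induction \<theta> rule: less_induct)
    case (less \<theta>)
    have st: "stage_le x {..<\<theta>} s t"
      unfolding stage_le_def using assms(3) less.IH D[OF less.prems] by auto
    have "true_stage x {..<\<theta>} t" using assms(2) D[OF less.prems] by (auto intro: true_stage_subset)
    show ?case
    proof (intro allI impI)
      fix w assume w: "rk w = \<theta>" "w < cnt (pre x s) (rk w)"
      then have "yes (pre x s) w \<longleftrightarrow> x \<in> nset w" using assms(1) less.prems by (simp add: true_stage_def)
      then show "yes (pre x s) w = yes (pre x t) w"
        using yes_mono[of x w s t] yes_true_stage[of x w t] st \<open>true_stage x {..<\<theta>} t\<close> w(1) by blast
    qed
  qed
  then show ?thesis using assms(3) by (auto simp: stage_le_def)
qed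

lemma true_stage_downward:
  assumes "stage_le x D r s" "true_stage x D s"
    and D: "\<And>\<theta> \<zeta>. \<theta> \<in> D \<Longrightarrow> \<zeta> \<le> \<theta> \<Longrightarrow> \<zeta> \<in> D"
  shows "true_stage x D r"
  unfolding true_stage_def
proof (intro allI impI)
  fix w assume w: "rk w \<in> D" "w < cnt (pre x r) (rk w)"
  have "{..rk w} \<subseteq> D" using D w(1) by auto
  then have "w < cnt (pre x s) (rk w)" using cnt_mono[OF stage_le_subset[OF assms(1)]] w(2) by fastforce
  then show "yes (pre x r) w \<longleftrightarrow> x \<in> nset w" using assms w by (auto simp: stage_le_def true_stage_def)
qed

text \<open>If the node is not open, some \<open>v\<close> in \<open>ch w\<close> omits
  \<open>x\<close>. After more than \<open>v\<close> stages true up to \<open>rk v\<close>, every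
  later stage true below \<open>rk w\<close> protects \<open>v\<close>, and it guesses no there
  because yes guesses of true stages are right.\<close>

lemma yes_eventually:
  assumes inf: "\<And>\<theta>. \<theta> < rk w \<Longrightarrow> infinite {s. true_stage x {..\<theta>} s}" and x: "x \<in> nset w"
  shows "\<exists>s0. \<forall>s\<ge>s0. true_stage x {..<rk w} s \<longrightarrow> yes (pre x s) w"
proof (cases "open (nset w)")
  case True
  then obtain n where "cyl (pre x n) \<subseteq> nset w" using open_contains_cyl x by blast
  then have "yes (pre x s) w" if "s \<ge> Suc n" for s
    using that cyl_pre_antimono[of n s x] by (auto simp: yes_open[OF True])
  then show ?thesis by blast
next
  case False
  then obtain v where v: "v \<in> ch w" "x \<notin> nset v" "rk v < rk w" using node[of w] x by auto
  obtain F where F: "F \<subseteq> {s. true_stage x {..rk v} s}" "finite F" "card F = Suc v"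
    using infinite_arbitrarily_large[OF inf[OF v(3)]] by blast
  obtain s0 where s0: "\<forall>s\<in>F. s < s0" using finite_nat_set_iff_bounded F(2) by blast
  have "yes (pre x s) w" if s: "s \<ge> s0" "true_stage x {..<rk w} s" for s
  proof -
    have tv: "true_stage x {..rk v} s" using s(2) v(3) by (auto intro: true_stage_subset)
    have "F \<subseteq> {r. r < s \<and> stage_le x {..rk v} r s}"
    proof
      fix r assume r: "r \<in> F"
      then have "r < s" using s0 s(1) by fastforce
      moreover have "stage_le x {..rk v} r s"
        using r F(1) tv \<open>r < s\<close> by (intro true_stage_imp_le) auto
      ultimately show "r \<in> {r. r < s \<and> stage_le x {..rk v} r s}" by simp
    qed
    then have "Suc v \<le> cnt (pre x s) (rk v)" unfolding cnt_pre F(3)[symmetric]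
      by (intro card_mono) auto
    moreover have "\<not> yes (pre x s) v"
      using yes_true_stage[of x v s] true_stage_subset[OF tv, of "{..<rk v}"] v(2) by force
    ultimately show ?thesis using False v(1) yes_not_open[OF False] by (meson Suc_le_lessD)
  qed
  then show ?thesis by blast
qed

section \<open>Infinitely many true stages\<close>

lemma cnt_le_if_predecessors_le:
  assumes "\<And>r. r < a \<Longrightarrow> stage_le x {..\<theta>} r a \<Longrightarrow> r \<le> m"
  shows "cnt (pre x a) \<theta> \<le> Suc m"
proof -
  have "{r. r < a \<and> stage_le x {..\<theta>} r a} \<subseteq> {..m}" using assms by auto
  then show ?thesis unfolding cnt_pre using card_mono[OF finite_atMost] by (metis card_atMost)
qed

lemma infinite_true_stage_atMost:
  assumes inf: "infinite {s. true_stage x {..<\<theta>} s}"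
    and inf': "\<And>\<zeta>. \<zeta> < \<theta> \<Longrightarrow> infinite {s. true_stage x {..\<zeta>} s}"
  shows "infinite {s. true_stage x {..\<theta>} s}"
proof
  assume "finite {s. true_stage x {..\<theta>} s}"
  then obtain m where m: "\<And>s. true_stage x {..\<theta>} s \<Longrightarrow> s \<le> m"
    by (metis finite_nat_set_iff_bounded_le mem_Collect_eq)
  have "\<exists>s0. \<forall>s\<ge>s0. true_stage x {..<\<theta>} s \<longrightarrow> rk w = \<theta> \<longrightarrow> (yes (pre x s) w \<longleftrightarrow> x \<in> nset w)" for w
    using yes_eventually[of w x] yes_true_stage[of x w] inf' by (cases "rk w = \<theta> \<and> x \<in> nset w") blast+
  then obtain g where g: "\<And>w s. s \<ge> g w \<Longrightarrow> true_stage x {..<\<theta>} s \<Longrightarrow> rk w = \<theta> \<Longrightarrow>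
      (yes (pre x s) w \<longleftrightarrow> x \<in> nset w)" by metis
  obtain s where s: "s > m" "true_stage x {..<\<theta>} s" "s > Max (g ` {..m})"
    using inf unfolding infinite_nat_iff_unbounded by (metis max_less_iff_conj mem_Collect_eq)
  have g': "yes (pre x s) w \<longleftrightarrow> x \<in> nset w" if "w \<le> m" "rk w = \<theta>" for w
  proof -
    have "g w \<le> Max (g ` {..m})" using that(1) by (intro Max_ge) auto
    then have "g w \<le> s" using s(3) by linarith
    then show ?thesis using g s(2) that(2) by blast
  qed
  \<comment> \<open>Minimality leaves \<open>a\<close> at most \<open>m + 1\<close> predecessors, so
    it protects no node of rank \<theta> beyond \<open>m\<close>, and its guesses on the others are
    those of \<open>s\<close>.\<close>
  define a where "a = (LEAST r. r > m \<and> stage_le x {..\<theta>} r s)"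
  have a: "a > m" "stage_le x {..\<theta>} a s"
    using LeastI[of "\<lambda>r. r > m \<and> stage_le x {..\<theta>} r s" s] s by (auto simp: a_def)
  have "cnt (pre x a) \<theta> \<le> Suc m"
  proof (rule cnt_le_if_predecessors_le)
    fix r assume r: "r < a" "stage_le x {..\<theta>} r a"
    then have "stage_le x {..\<theta>} r s" using a(2) stage_le_trans_atMost by blast
    then show "r \<le> m" using not_less_Least[OF r(1)[unfolded a_def]] by simp
  qed
  then have "true_stage x {..\<theta>} a"
    unfolding true_stage_def
  proof (intro allI impI)
    fix w assume w: "rk w \<in> {..\<theta>}" "w < cnt (pre x a) (rk w)"
    have ys: "yes (pre x a) w = yes (pre x s) w" using a(2) w by (auto simp: stage_le_def)
    show "yes (pre x a) w \<longleftrightarrow> x \<in> nset w"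
    proof (cases "rk w = \<theta>")
      case True
      then show ?thesis using g' ys w \<open>cnt (pre x a) \<theta> \<le> Suc m\<close> by auto
    next
      case False
      have "w < cnt (pre x s) (rk w)"
        using cnt_mono[OF stage_le_subset[OF a(2)], of "rk w"] w by fastforce
      then show ?thesis using s(2) ys False w(1) by (auto simp: true_stage_def)
    qed
  qed
  then show False using m[of a] a(1) by simp
qed

lemma infinite_true_stage_lessThan:
  assumes inf: "\<And>\<zeta>. \<zeta> < \<theta> \<Longrightarrow> infinite {s. true_stage x {..\<zeta>} s}"
  shows "infinite {s. true_stage x {..<\<theta>} s}"
proof
  assume "finite {s. true_stage x {..<\<theta>} s}"
  then obtain m where m: "\<And>s. true_stage x {..<\<theta>} s \<Longrightarrow> s \<le> m"
    by (metis finite_nat_set_iff_bounded_le mem_Collect_eq)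
  \<comment> \<open>The ranks of the nodes up to \<open>m\<close>. At a rank above all of
    \<open>W\<close>, a stage whose predecessors are at most \<open>m\<close> protects no node at
    all.\<close>
  define W where "W = {rk w | w. w \<le> m \<and> rk w < \<theta>}"
  have "finite W" unfolding W_def by simp
  have "\<exists>a>m. (\<forall>\<zeta>\<in>W. true_stage x {..\<zeta>} a) \<and>
      (\<forall>\<zeta> r. \<zeta> < \<theta> \<longrightarrow> \<zeta> \<notin> {\<zeta>. \<exists>\<delta>\<in>W. \<zeta> \<le> \<delta>} \<longrightarrow> r < a \<longrightarrow> stage_le x {..\<zeta>} r a \<longrightarrow> r \<le> m)"
  proof (cases "W = {}")
    case True
    then show ?thesis by (intro exI[of _ "Suc m"]) auto
  next
    case False
    define \<delta> where "\<delta> = Max W"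
    have \<delta>: "\<delta> \<in> W" "\<And>\<zeta>. \<zeta> \<in> W \<Longrightarrow> \<zeta> \<le> \<delta>" using False \<open>finite W\<close> by (auto simp: \<delta>_def)
    then have "\<delta> < \<theta>" by (auto simp: W_def)
    then obtain s where s: "s > m" "true_stage x {..\<delta>} s"
      using inf unfolding infinite_nat_iff_unbounded by blast
    \<comment> \<open>A predecessor of \<open>a\<close> at a rank above \<delta> is itself true up
      to \<delta>, hence at most \<open>m\<close> by minimality.\<close>
    define a where "a = (LEAST r. r > m \<and> true_stage x {..\<delta>} r)"
    have a: "a > m" "true_stage x {..\<delta>} a"
      using LeastI[of "\<lambda>r. r > m \<and> true_stage x {..\<delta>} r" s] s by (auto simp: a_def)
    have "r \<le> m" if "\<delta> < \<zeta>" "r < a" "stage_le x {..\<zeta>} r a" for \<zeta> r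
    proof -
      have "stage_le x {..\<delta>} r a" using that by (auto intro: stage_le_subset)
      then have "true_stage x {..\<delta>} r" using a(2) by (rule true_stage_downward) auto
      then show ?thesis using not_less_Least[OF that(2)[unfolded a_def]] by simp
    qed
    moreover have "true_stage x {..\<zeta>} a" if "\<zeta> \<in> W" for \<zeta>
      using true_stage_subset[OF a(2), of "{..\<zeta>}"] \<delta>(2)[OF that] by simp
    ultimately show ?thesis using a(1) \<delta>(1) by (intro exI[of _ a]) (auto simp: not_le)
  qed
  then obtain a where a: "a > m" "\<And>\<zeta>. \<zeta> \<in> W \<Longrightarrow> true_stage x {..\<zeta>} a"
    "\<And>\<zeta> r. \<zeta> < \<theta> \<Longrightarrow> (\<And>\<delta>. \<delta> \<in> W \<Longrightarrow> \<not> \<zeta> \<le> \<delta>) \<Longrightarrow> r < a \<Longrightarrow> stage_le x {..\<zeta>} r a \<Longrightarrow> r \<le> m"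
    by blast
  have "true_stage x {..<\<theta>} a"
    unfolding true_stage_def
  proof (intro allI impI)
    fix w assume w: "rk w \<in> {..<\<theta>}" "w < cnt (pre x a) (rk w)"
    show "yes (pre x a) w \<longleftrightarrow> x \<in> nset w"
    proof (cases "\<exists>\<delta>\<in>W. rk w \<le> \<delta>")
      case True
      then show ?thesis using a(2) w(2) by (auto simp: true_stage_def)
    next
      case False
      then have "cnt (pre x a) (rk w) \<le> Suc m"
        using a(3)[of "rk w"] w(1) by (intro cnt_le_if_predecessors_le) auto
      then have "rk w \<in> W" using w by (auto simp: W_def)
      then show ?thesis using False by auto
    qed
  qed
  then show False using m[of a] a(1) by simp
qed

lemma infinite_true_stage: "infinite {s. true_stage x {..\<theta>} s}"
proof (induction \<theta> rule: less_induct)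
  case (less \<theta>)
  have "infinite {s. true_stage x {..<\<theta>} s}" by (rule infinite_true_stage_lessThan) (rule less.IH)
  then show ?case by (rule infinite_true_stage_atMost) (rule less.IH)
qed

text \<open>
  The least stage of the chain of \<open>r\<close> that is dropped at \<open>t\<close> has all its predecessors below \<open>t\<close>.
  If the least node on which \<open>r\<close> and \<open>t\<close> disagree were not protected at \<open>t\<close>, then all nodes
  protected at that stage would be smaller, and it would not be dropped.
\<close>

lemma certified_if_dropped:
  assumes "r < t" "stage_le x {..<\<theta>} r t" "\<not> stage_le x {..\<theta>} r t"
  shows "\<exists>w. rk w = \<theta> \<and> w < cnt (pre x t) \<theta>"
proof -
  define bad where "bad w \<longleftrightarrow> rk w = \<theta> \<and> w < cnt (pre x r) \<theta> \<and>
      yes (pre x r) w \<noteq> yes (pre x t) w" for w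
  obtain v where v: "rk v \<le> \<theta>" "v < cnt (pre x r) (rk v)" "yes (pre x r) v \<noteq> yes (pre x t) v"
    using assms(1,3) by (auto simp: stage_le_def)
  then have "rk v = \<theta>" using assms(2) by (force simp: stage_le_def)
  then have "\<exists>w. bad w" using v bad_def by blast
  then obtain w where w: "bad w" "\<And>v. v < w \<Longrightarrow> \<not> bad v" using exists_least_iff[of bad] by blast
  define b where "b = (LEAST b. stage_le x {..\<theta>} b r \<and> \<not> stage_le x {..\<theta>} b t)"
  have b: "stage_le x {..\<theta>} b r" "\<not> stage_le x {..\<theta>} b t"
    using LeastI[of "\<lambda>b. stage_le x {..\<theta>} b r \<and> \<not> stage_le x {..\<theta>} b t" r] assms(3) by (auto simp: b_def)
  have "{s. s < b \<and> stage_le x {..\<theta>} s b} \<subseteq> {s. s < t \<and> stage_le x {..\<theta>} s t}"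
  proof safe
    fix s assume s: "s < b" "stage_le x {..\<theta>} s b"
    show "s < t" using s(1) stage_le_imp_le[OF b(1)] assms(1) by simp
    have "stage_le x {..\<theta>} s r" using stage_le_trans_atMost[OF s(2) b(1)] .
    then show "stage_le x {..\<theta>} s t" using not_less_Least[OF s(1)[unfolded b_def]] by simp
  qed
  then have bt: "cnt (pre x b) \<theta> \<le> cnt (pre x t) \<theta>"
    unfolding cnt_pre by (intro card_mono) auto
  have "w < cnt (pre x t) \<theta>"
  proof (rule ccontr)
    assume "\<not> ?thesis"
    have "stage_le x {..\<theta>} b t"
      unfolding stage_le_def
    proof (intro conjI allI impI)
      show "b \<le> t" using stage_le_imp_le[OF b(1)] assms(1) by simp
      fix v assume v: "rk v \<in> {..\<theta>}" "v < cnt (pre x b) (rk v)"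
      have vr: "v < cnt (pre x r) (rk v)"
        using cnt_mono[OF stage_le_subset[OF b(1)], of "rk v"] v by fastforce
      have "yes (pre x b) v = yes (pre x r) v" using b(1) v by (auto simp: stage_le_def)
      also have "\<dots> = yes (pre x t) v"
      proof (cases "rk v = \<theta>")
        case True
        then have "v < w" using v(2) bt \<open>\<not> w < cnt (pre x t) \<theta>\<close> by simp
        then show ?thesis using w(2) vr True by (auto simp: bad_def)
      next
        case False
        then show ?thesis using assms(2) v(1) vr by (auto simp: stage_le_def)
      qed
      finally show "yes (pre x b) v = yes (pre x t) v" .
    qed
    then show False using b(2) by simp
  qed
  then show ?thesis using w(1) by (auto simp: bad_def)
qed

end

section \<open>Labels\<close>

definition sigma_ideal :: "'a set set \<Rightarrow> bool" where
  "sigma_ideal I \<longleftrightarrow> {} \<in> I \<and> (\<forall>D\<in>I. Pow D \<subseteq> I) \<and> (\<forall>F::nat \<Rightarrow> _. range F \<subseteq> I \<longrightarrow> \<Union>(range F) \<in> I)"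

lemma sigma_ideal_empty: "sigma_ideal I \<Longrightarrow> {} \<in> I"
  by (simp add: sigma_ideal_def)

lemma sigma_ideal_subset: "sigma_ideal I \<Longrightarrow> D \<in> I \<Longrightarrow> D' \<subseteq> D \<Longrightarrow> D' \<in> I"
  by (auto simp: sigma_ideal_def)

lemma sigma_ideal_UN:
  assumes "sigma_ideal I" "\<And>n::'i::countable. F n \<in> I"
  shows "(\<Union>n. F n) \<in> I"
proof -
  have "range (\<lambda>n::nat. F (from_nat n)) \<subseteq> I" using assms(2) by auto
  then have "(\<Union>n::nat. F (from_nat n)) \<in> I" using assms(1) unfolding sigma_ideal_def by blast
  moreover have "(\<Union>n. F n) = (\<Union>n::nat. F (from_nat n))"
    by (auto intro: from_nat_to_nat[symmetric]) (metis from_nat_to_nat)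
  ultimately show ?thesis by simp
qed

lemma sigma_ideal_Un:
  assumes "sigma_ideal I" "A \<in> I" "B \<in> I"
  shows "A \<union> B \<in> I"
proof -
  have "(\<Union>b::bool. if b then A else B) \<in> I" using assms by (intro sigma_ideal_UN) auto
  then show ?thesis by (rule sigma_ideal_subset[OF assms(1)]) (auto split: if_splits)
qed

text \<open>
  A label \<open>(E, I)\<close> consists of the candidates for a value and its witness, and of an ideal of
  negligible sets of candidates.
\<close>

type_synonym label = "(baire \<times> baire) set \<times> (baire \<times> baire) set set"

text \<open>\<open>G \<theta>\<close> abstracts the Borel class of index 1 + \<theta> to its closure
  properties; \<open>u\<close> is the node coding \<open>A\<close>.\<close>

locale separation = node_family nset rk ch
  for nset :: "nat \<Rightarrow> baire set" and rk :: "nat \<Rightarrow> 'r::wellorder" and ch :: "nat \<Rightarrow> nat set" +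
  fixes G :: "'r \<Rightarrow> baire set set" and u :: nat and C\<^sub>0 C\<^sub>1 :: "(baire \<times> baire) set"
  assumes G_open: "open V \<Longrightarrow> V \<in> G \<theta>"
    and G_UN: "(\<And>n::nat. F n \<in> G \<theta>) \<Longrightarrow> (\<Union>n. F n) \<in> G \<theta>"
    and G_mono: "V \<in> G \<theta> \<Longrightarrow> \<theta> \<le> \<theta>' \<Longrightarrow> V \<in> G \<theta>'"
    and G_compl: "V \<in> G \<theta> \<Longrightarrow> \<theta> < \<theta>' \<Longrightarrow> - V \<in> G \<theta>'"
    and not_separable: "V \<in> G (rk u) \<Longrightarrow> fst ` C\<^sub>0 \<subseteq> V \<Longrightarrow> V \<inter> fst ` C\<^sub>1 \<noteq> {}"
begin

lemma G_Un: "V \<in> G \<theta> \<Longrightarrow> W \<in> G \<theta> \<Longrightarrow> V \<union> W \<in> G \<theta>"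
proof -
  assume "V \<in> G \<theta>" "W \<in> G \<theta>"
  then have "(\<Union>n::nat. if n = 0 then V else W) \<in> G \<theta>" by (intro G_UN) auto
  moreover have "(\<Union>n::nat. if n = 0 then V else W) = V \<union> W"
    by (auto split: if_splits)
  ultimately show ?thesis by simp
qed

lemma G_finite_UN: "finite S \<Longrightarrow> (\<And>\<zeta>. \<zeta> \<in> S \<Longrightarrow> V \<zeta> \<in> G \<theta>) \<Longrightarrow> (\<Union>\<zeta>\<in>S. V \<zeta>) \<in> G \<theta>"
  by (induction S rule: finite_induct) (auto intro: G_Un G_open)

text \<open>The complement is a finite union inside \<open>G (Max S)\<close>, and
  \<open>Max S\<close> lies below \<theta>. For empty \<open>S\<close> there may be no smaller rank,
  but then the set is open.\<close>

lemma G_Diff: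
  assumes "open (- N)" "open N" "finite S" "\<And>\<zeta>. \<zeta> \<in> S \<Longrightarrow> \<zeta> < \<theta> \<and> V \<zeta> \<in> G \<zeta>"
  shows "N - (\<Union>\<zeta>\<in>S. V \<zeta>) \<in> G \<theta>"
proof (cases "S = {}")
  case True
  then show ?thesis using assms(2) by (simp add: G_open)
next
  case False
  have "V \<zeta> \<in> G (Max S)" if "\<zeta> \<in> S" for \<zeta>
    using assms(3,4) that by (meson G_mono Max_ge)
  then have "- N \<union> (\<Union>\<zeta>\<in>S. V \<zeta>) \<in> G (Max S)"
    using assms(1,3) by (intro G_Un G_finite_UN) (auto intro: G_open)
  moreover have "Max S < \<theta>" using assms(3,4) False by auto
  ultimately have "- (- N \<union> (\<Union>\<zeta>\<in>S. V \<zeta>)) \<in> G \<theta>" by (rule G_compl)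
  then show ?thesis by (simp add: Diff_eq)
qed

text \<open>The last proper predecessor in the order for \<open>D\<close>. For a nonempty string the
  maximum exists, because the empty string protects nothing and so precedes every string.\<close>

definition pred_stage :: "'r set \<Rightarrow> nat list \<Rightarrow> nat" where
  "pred_stage D \<sigma> = Max {r. r < length \<sigma> \<and> (\<forall>w. rk w \<in> D \<longrightarrow> w < cnt (take r \<sigma>) (rk w) \<longrightarrow>
     yes (take r \<sigma>) w = yes \<sigma> w)}"

text \<open>By \<open>certified_if_dropped\<close>, the only ranks below \<open>rk u\<close> at
  which an earlier stage kept so far can be lost.\<close>

definition certified :: "nat list \<Rightarrow> 'r set" where
  "certified \<sigma> = {rk w | w. w < cnt \<sigma> (rk w) \<and> rk w < rk u}"

text \<open>
  If \<open>k\<close> is the label of an earlier stage and \<open>dominates \<theta> k l\<close>, then what is negligible at \<open>k\<close>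
  stays so at \<open>l\<close>, whence one can return from \<open>l\<close> to \<open>k\<close> when a guess of rank \<open>\<theta>\<close> fails.
\<close>

definition dominates :: "'r \<Rightarrow> label \<Rightarrow> label \<Rightarrow> bool" where
  "dominates \<theta> k l \<longleftrightarrow> (\<forall>V\<in>G \<theta>. fst k \<inter> V \<times> UNIV \<in> snd k \<longrightarrow> fst l \<inter> V \<times> UNIV \<in> snd l)"

text \<open>By \<open>yes_mono\<close> the guess about \<open>A\<close> can only switch from no to
  yes here, so a switch always restarts from \<open>C\<^sub>1\<close>, with only the empty set
  negligible.\<close>

definition base :: "(nat list \<Rightarrow> label) \<Rightarrow> nat list \<Rightarrow> label" where
  "base f \<sigma> = (let \<rho> = take (pred_stage {..<rk u} \<sigma>) \<sigma> in
     if yes \<sigma> u = yes \<rho> u then f \<rho> else (C\<^sub>1, {{}}))"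

text \<open>That \<open>C\<^sub>0\<close> is not in this ideal says exactly that the two projections
  are inseparable.\<close>

definition root_ideal :: "(baire \<times> baire) set set" where
  "root_ideal = {D. \<exists>V\<in>G (rk u). fst ` D \<subseteq> V \<and> V \<inter> fst ` C\<^sub>1 = {}}"

text \<open>The inclusion and domination clauses refer to predecessors in the orders of guesses. The
  last clause refers to the string just before, whatever its guesses; it makes the values fit
  together on all branches.\<close>

definition step :: "(nat list \<Rightarrow> label) \<Rightarrow> nat list \<Rightarrow> label \<Rightarrow> bool" where
  "step f \<sigma> l \<longleftrightarrow> sigma_ideal (snd l) \<and> fst l \<notin> snd l \<and>
     (if \<sigma> = [] then l = (C\<^sub>0, root_ideal)
      else fst l \<subseteq> fst (base f \<sigma>) \<and> snd (base f \<sigma>) \<subseteq> snd l \<and>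
        (\<forall>\<theta>\<in>certified \<sigma>. dominates \<theta> (f (take (pred_stage {..\<theta>} \<sigma>) \<sigma>)) l) \<and>
        (\<forall>p\<in>fst l. \<forall>q\<in>fst l. \<forall>i<length \<sigma>. fst p i = fst q i \<and> snd p i = snd q i) \<and>
        (\<forall>p\<in>fst l. \<forall>q\<in>fst (f (butlast \<sigma>)). \<forall>i<length \<sigma> - 1. fst p i = fst q i))"

section \<open>Predecessors of a stage\<close>

lemma cnt_0 [simp]: "cnt [] \<theta> = 0"
  using cnt_pre[of undefined 0 \<theta>] by simp

text \<open>The purpose of the condition \<open>\<sigma> \<noteq> []\<close> in \<open>yes\<close>:
  the root always guesses no, in accordance with its label \<open>C\<^sub>0\<close>.\<close>

lemma yes_Nil [simp]: "\<not> yes [] w"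
  by (cases "open (nset w)") (simp_all add: yes_open yes_not_open)

lemma stage_le_0 [simp]: "stage_le x D 0 t" by (simp add: stage_le_def)

lemma pred_stage_pre: "pred_stage D (pre x t) = Max {r. r < t \<and> stage_le x D r t}"
  unfolding pred_stage_def stage_le_def by (rule arg_cong[where f = Max]) auto

lemma
  assumes "0 < t"
  shows pred_stage_less: "pred_stage D (pre x t) < t"
    and stage_le_pred: "stage_le x D (pred_stage D (pre x t)) t"
    and pred_stage_greatest: "\<And>r. r < t \<Longrightarrow> stage_le x D r t \<Longrightarrow> r \<le> pred_stage D (pre x t)"
proof -
  have "finite {r. r < t \<and> stage_le x D r t}" "{r. r < t \<and> stage_le x D r t} \<noteq> {}"
    using assms stage_le_0 by (auto intro!: exI[of _ 0])
  from Max_in[OF this] Max_ge[OF this(1)]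
  show "pred_stage D (pre x t) < t" "stage_le x D (pred_stage D (pre x t)) t"
    "\<And>r. r < t \<Longrightarrow> stage_le x D r t \<Longrightarrow> r \<le> pred_stage D (pre x t)"
    unfolding pred_stage_pre by auto
qed

text \<open>Induction on the rank: by \<open>certified_if_dropped\<close>, an uncertified rank loses
  no earlier stage that the lower ranks keep.\<close>

lemma stage_le_lessThan_if_uncertified:
  assumes "0 < t" "r < t" "stage_le x D r t" and D: "\<And>\<zeta> \<eta>. \<zeta> \<in> D \<Longrightarrow> \<eta> \<le> \<zeta> \<Longrightarrow> \<eta> \<in> D"
    and "\<And>\<zeta>. \<zeta> < \<theta> \<Longrightarrow> \<zeta> \<notin> D \<Longrightarrow> \<zeta> \<notin> certified (pre x t)" and "\<theta> \<le> rk u"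
  shows "stage_le x {..<\<theta>} r t"
proof -
  have "stage_le x {..\<zeta>} r t" if "\<zeta> < \<theta>" for \<zeta>
    using that
  proof (induction \<zeta> rule: less_induct)
    case (less \<zeta>)
    show ?case
    proof (cases "\<zeta> \<in> D")
      case True
      then have "{..\<zeta>} \<subseteq> D" using D by auto
      then show ?thesis using assms(3) stage_le_subset by blast
    next
      case False
      have "stage_le x {..\<eta>} r t" if "\<eta> < \<zeta>" for \<eta> using less that by (meson order.strict_trans)
      then have "stage_le x {..<\<zeta>} r t" using assms(2) by (auto simp: stage_le_def)
      moreover have "\<not> (\<exists>w. rk w = \<zeta> \<and> w < cnt (pre x t) \<zeta>)"
        using assms(5)[OF less.prems False] assms(6) less.prems by (auto simp: certified_def)
      ultimately show ?thesis using certified_if_dropped[OF assms(2)] by blast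
    qed
  qed
  then show ?thesis using assms(2) by (auto simp: stage_le_def)
qed

text \<open>The predecessor moves only at certified ranks. With the next lemma, the passage through
  all ranks below \<open>rk u\<close> becomes a finite walk back from \<open>t - 1\<close>.\<close>

lemma pred_stage_lessThan_eq:
  assumes "0 < t" "\<delta> < \<theta>" "\<theta> \<le> rk u" "\<And>\<zeta>. \<delta> < \<zeta> \<Longrightarrow> \<zeta> < \<theta> \<Longrightarrow> \<zeta> \<notin> certified (pre x t)"
  shows "pred_stage {..<\<theta>} (pre x t) = pred_stage {..\<delta>} (pre x t)"
proof (rule antisym)
  show "pred_stage {..<\<theta>} (pre x t) \<le> pred_stage {..\<delta>} (pre x t)"
    using assms(1,2) by (intro pred_stage_greatest pred_stage_less stage_le_subset[OF stage_le_pred]) auto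
  show "pred_stage {..\<delta>} (pre x t) \<le> pred_stage {..<\<theta>} (pre x t)"
    using assms by (intro pred_stage_greatest pred_stage_less stage_le_lessThan_if_uncertified[where D = "{..\<delta>}"] stage_le_pred) (auto simp: not_le)
qed

lemma pred_stage_lessThan_eq_pred:
  assumes "0 < t" "\<theta> \<le> rk u" "\<And>\<zeta>. \<zeta> < \<theta> \<Longrightarrow> \<zeta> \<notin> certified (pre x t)"
  shows "pred_stage {..<\<theta>} (pre x t) = t - 1"
proof (rule antisym)
  show "pred_stage {..<\<theta>} (pre x t) \<le> t - 1" using pred_stage_less[OF assms(1), of "{..<\<theta>}" x] by simp
  have "stage_le x {} (t - 1) t" by (simp add: stage_le_def)
  then show "t - 1 \<le> pred_stage {..<\<theta>} (pre x t)"
    using assms by (intro pred_stage_greatest stage_le_lessThan_if_uncertified[where D = "{}"]) auto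
qed

lemma finite_certified: "finite (certified \<sigma>)"
proof -
  have "cnt \<sigma> \<theta> \<le> length \<sigma>" for \<theta>
  proof -
    have "{r. r < length \<sigma> \<and> (\<forall>u. rk u \<le> \<theta> \<longrightarrow> u < cnt (take r \<sigma>) (rk u) \<longrightarrow>
        yes (take r \<sigma>) u = yes \<sigma> u)} \<subseteq> {..<length \<sigma>}" by auto
    then show ?thesis by (subst cnt.simps) (use card_mono[OF finite_lessThan] in fastforce)
  qed
  then have "certified \<sigma> \<subseteq> rk ` {..<length \<sigma>}"
    by (auto simp: certified_def dest: less_le_trans)
  then show ?thesis using finite_surj by blast
qed

lemma butlast_pre: "butlast (pre x t) = pre x (t - 1)"
  by (simp add: butlast_conv_take)

lemma
  assumes "step f (pre x t) l"
  shows step_ideal: "sigma_ideal (snd l)"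
    and step_positive: "fst l \<notin> snd l"
    and step_Nil: "t = 0 \<Longrightarrow> l = (C\<^sub>0, root_ideal)"
    and step_base: "0 < t \<Longrightarrow> fst l \<subseteq> fst (base f (pre x t))"
      "0 < t \<Longrightarrow> snd (base f (pre x t)) \<subseteq> snd l"
    and step_dominates: "0 < t \<Longrightarrow> \<theta> \<in> certified (pre x t) \<Longrightarrow>
      dominates \<theta> (f (pre x (pred_stage {..\<theta>} (pre x t)))) l"
    and step_agree: "p \<in> fst l \<Longrightarrow> q \<in> fst l \<Longrightarrow> i < t \<Longrightarrow> fst p i = fst q i \<and> snd p i = snd q i"
    and step_agree_pred: "p \<in> fst l \<Longrightarrow> q \<in> fst (f (pre x (t - 1))) \<Longrightarrow> i < t - 1 \<Longrightarrow> fst p i = fst q i"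
proof -
  have *: "pre x t = [] \<longleftrightarrow> t = 0" by simp
  note st = assms[unfolded step_def * butlast_pre length_pre]
  show "sigma_ideal (snd l)" "fst l \<notin> snd l" using st by blast+
  show "l = (C\<^sub>0, root_ideal)" if "t = 0" using st that by simp
  show "fst l \<subseteq> fst (base f (pre x t))" "snd (base f (pre x t)) \<subseteq> snd l" if "0 < t"
    using st that by simp_all
  show "dominates \<theta> (f (pre x (pred_stage {..\<theta>} (pre x t)))) l" if "0 < t" "\<theta> \<in> certified (pre x t)"
  proof -
    have "dominates \<theta> (f (take (pred_stage {..\<theta>} (pre x t)) (pre x t))) l"
      using st that by (metis less_irrefl)
    then show ?thesis using pred_stage_less[OF that(1), of "{..\<theta>}" x] by simp
  qed
  show "fst p i = fst q i \<and> snd p i = snd q i" if "p \<in> fst l" "q \<in> fst l" "i < t"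
    using st that by (metis not_less0)
  show "fst p i = fst q i" if "p \<in> fst l" "q \<in> fst (f (pre x (t - 1)))" "i < t - 1"
    using st that by (metis diff_0_eq_0 not_less0)
qed

lemma stepI:
  assumes "0 < t" "sigma_ideal (snd l)" "fst l \<notin> snd l"
    "fst l \<subseteq> fst (base f (pre x t))" "snd (base f (pre x t)) \<subseteq> snd l"
    "\<And>\<theta>. \<theta> \<in> certified (pre x t) \<Longrightarrow> dominates \<theta> (f (pre x (pred_stage {..\<theta>} (pre x t)))) l"
    "\<And>p q i. p \<in> fst l \<Longrightarrow> q \<in> fst l \<Longrightarrow> i < t \<Longrightarrow> fst p i = fst q i \<and> snd p i = snd q i"
    "\<And>p q i. p \<in> fst l \<Longrightarrow> q \<in> fst (f (pre x (t - 1))) \<Longrightarrow> i < t - 1 \<Longrightarrow> fst p i = fst q i"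
  shows "step f (pre x t) l"
proof -
  have *: "take (pred_stage {..\<theta>} (pre x t)) (pre x t) = pre x (pred_stage {..\<theta>} (pre x t))" for \<theta>
    using pred_stage_less[OF assms(1), of "{..\<theta>}" x] by simp
  have "pre x t \<noteq> []" using assms(1) by simp
  then show ?thesis unfolding step_def butlast_pre length_pre * if_not_P[OF \<open>pre x t \<noteq> []\<close>]
    using assms(2-) by blast
qed

section \<open>Labelling one more string\<close>

context
  fixes f :: "nat list \<Rightarrow> label" and x :: baire and t :: nat
  assumes step: "\<And>s. s < t \<Longrightarrow> step f (pre x s) (f (pre x s))"
begin

text \<open>Inherited from predecessors until the guess switches to yes. That no labels neglect all
  of \<open>root_ideal\<close> is what \<open>base_positive\<close> needs at a switch.\<close>

lemma base_label:
  assumes "s < t"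
  shows "if yes (pre x s) u then fst (f (pre x s)) \<subseteq> C\<^sub>1
    else fst (f (pre x s)) \<subseteq> C\<^sub>0 \<and> root_ideal \<subseteq> snd (f (pre x s))"
  using assms
proof (induction s rule: less_induct)
  case (less s)
  show ?case
  proof (cases "s = 0")
    case True
    then show ?thesis using step_Nil[OF step[OF less.prems]] by simp
  next
    case False
    let ?p = "pred_stage {..<rk u} (pre x s)"
    have p: "?p < s" "stage_le x {..<rk u} ?p s" using pred_stage_less stage_le_pred False by auto
    have IH: "if yes (pre x ?p) u then fst (f (pre x ?p)) \<subseteq> C\<^sub>1
      else fst (f (pre x ?p)) \<subseteq> C\<^sub>0 \<and> root_ideal \<subseteq> snd (f (pre x ?p))"
      using less.IH[OF p(1)] less.prems p(1) by simp
    have st: "fst (f (pre x s)) \<subseteq> fst (base f (pre x s))" "snd (base f (pre x s)) \<subseteq> snd (f (pre x s))"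
      using step_base[OF step[OF less.prems]] False by simp_all
    show ?thesis
    proof (cases "yes (pre x s) u = yes (pre x ?p) u")
      case True
      then have "base f (pre x s) = f (pre x ?p)" using p(1) by (simp add: base_def Let_def)
      then show ?thesis using st IH True by (auto split: if_splits)
    next
      case False
      then have "base f (pre x s) = (C\<^sub>1, {{}})" using p(1) by (simp add: base_def Let_def)
      moreover have "yes (pre x s) u" using False yes_mono[OF p(2)] by blast
      ultimately show ?thesis using st by auto
    qed
  qed
qed

text \<open>Domination composes along the chain from the first stage \<open>p\<close> to the second,
  \<open>q\<close>. Each later stage \<open>a\<close> of the chain is lost at \<open>t\<close>
  because of a guess of rank \<theta> protected at \<open>a\<close>; so \<theta> is certified at
  \<open>a\<close>, and \<open>step\<close> makes the label of \<open>a\<close> dominate that of its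
  predecessor.\<close>

lemma dominates_path:
  assumes t: "0 < t" and \<theta>: "\<theta> < rk u"
  shows "dominates \<theta> (f (pre x (pred_stage {..\<theta>} (pre x t)))) (f (pre x (pred_stage {..<\<theta>} (pre x t))))"
proof -
  define p where "p = pred_stage {..\<theta>} (pre x t)"
  define q where "q = pred_stage {..<\<theta>} (pre x t)"
  have p: "p < t" "stage_le x {..\<theta>} p t" "\<And>r. r < t \<Longrightarrow> stage_le x {..\<theta>} r t \<Longrightarrow> r \<le> p"
    using pred_stage_less stage_le_pred pred_stage_greatest t by (auto simp: p_def)
  have q: "q < t" "stage_le x {..<\<theta>} q t" using pred_stage_less stage_le_pred t by (auto simp: q_def)
  have "stage_le x {..<\<theta>} p t" using p(2) by (auto intro: stage_le_subset)
  then have "p \<le> q" using pred_stage_greatest[OF t p(1)] by (simp add: q_def)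
  have pq: "stage_le x {..\<theta>} p q"
    by (rule stage_le_interpolate[OF p(2) \<open>p \<le> q\<close> stage_le_subset[OF q(2)]]) auto
  have "fst (f (pre x a)) \<inter> V \<times> UNIV \<in> snd (f (pre x a))"
    if V: "V \<in> G \<theta>" "fst (f (pre x p)) \<inter> V \<times> UNIV \<in> snd (f (pre x p))"
      and "p \<le> a" "stage_le x {..\<theta>} a q" for V a
    using that(3,4)
  proof (induction a rule: less_induct)
    case (less a)
    show ?case
    proof (cases "a = p")
      case True
      then show ?thesis using V(2) by simp
    next
      case False
      then have a: "p < a" "0 < a" "a < t" using less.prems stage_le_imp_le[OF less.prems(2)] q(1) by auto
      have a_t: "stage_le x {..<\<theta>} a t"
        by (rule stage_le_trans[OF stage_le_subset[OF less.prems(2)] q(2)]) auto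
      have "\<not> stage_le x {..\<theta>} a t" using p(3)[OF a(3)] a(1) by auto
      then obtain w where w: "rk w \<le> \<theta>" "w < cnt (pre x a) (rk w)" "yes (pre x a) w \<noteq> yes (pre x t) w"
        using a(3) by (auto simp: stage_le_def)
      have "rk w = \<theta>" using w a_t by (force simp: stage_le_def)
      then have cert: "\<theta> \<in> certified (pre x a)" using w(2) \<theta> by (auto simp: certified_def)
      let ?b = "pred_stage {..\<theta>} (pre x a)"
      have b: "?b < a" "stage_le x {..\<theta>} ?b a" using pred_stage_less stage_le_pred a(2) by auto
      have "stage_le x {..\<theta>} p a"
        by (rule stage_le_interpolate[OF pq less.prems(1) stage_le_subset[OF less.prems(2)]]) auto
      then have "p \<le> ?b" using pred_stage_greatest a(1,2) by auto
      then have "fst (f (pre x ?b)) \<inter> V \<times> UNIV \<in> snd (f (pre x ?b))"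
        using less.IH[OF b(1)] stage_le_trans_atMost[OF b(2) less.prems(2)] by simp
      moreover have "dominates \<theta> (f (pre x ?b)) (f (pre x a))"
        using step_dominates[OF step[OF a(3)] a(2) cert] .
      ultimately show ?thesis using V(1) by (auto simp: dominates_def)
    qed
  qed
  from this[OF _ _ \<open>p \<le> q\<close> stage_le_refl] show ?thesis
    unfolding dominates_def p_def[symmetric] q_def[symmetric] by blast
qed

text \<open>The clopen cylinder to which the last clause of \<open>step\<close> confines the values
  of the new label.\<close>

definition nbhd :: "baire set" where
  "nbhd = {y. \<forall>q\<in>fst (f (pre x (t - 1))). \<forall>i<t - 1. y i = fst q i}"

lemma
  assumes "0 < t"
  shows open_nbhd: "open nbhd" "open (- nbhd)"
    and subset_nbhd: "fst (f (pre x (t - 1))) \<subseteq> nbhd \<times> UNIV"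
proof -
  let ?E = "fst (f (pre x (t - 1)))"
  have st: "step f (pre x (t - 1)) (f (pre x (t - 1)))" using step assms by simp
  then obtain q where q: "q \<in> ?E" using sigma_ideal_empty[OF step_ideal] step_positive[OF st]
    by (metis all_not_in_conv)
  have *: "fst p i = fst q i" if "p \<in> ?E" "q \<in> ?E" "i < t - 1" for p q i
    using step_agree[OF st that] by simp
  then have "nbhd = cyl (pre (fst q) (t - 1))"
    unfolding nbhd_def set_eq_iff mem_Collect_eq mem_cyl_pre using q by metis
  then show "open nbhd" "open (- nbhd)" using open_cyl closed_cyl by auto
  show "?E \<subseteq> nbhd \<times> UNIV"
  proof
    fix p assume "p \<in> ?E"
    then have "fst p \<in> nbhd" unfolding nbhd_def using * by blast
    then show "p \<in> nbhd \<times> UNIV" by (simp add: mem_Times_iff)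
  qed
qed

text \<open>
  The certified ranks are passed in increasing order.  At a rank \<open>\<delta>\<close> the set removed so far is in
  \<open>G\<close> of a smaller rank, so its complement is in \<open>G \<delta>\<close> and positivity moves down from the
  predecessor below \<open>\<delta>\<close> to the one at \<open>\<delta>\<close> by domination.
\<close>

lemma positive_below:
  assumes t: "0 < t" and "\<theta> \<le> rk u"
    and V: "\<And>\<zeta>. \<zeta> \<in> certified (pre x t) \<Longrightarrow> V \<zeta> \<in> G \<zeta>"
    and small: "\<And>\<zeta>. \<zeta> \<in> certified (pre x t) \<Longrightarrow>
      fst (f (pre x (pred_stage {..\<zeta>} (pre x t)))) \<inter> V \<zeta> \<times> UNIV \<in> snd (f (pre x (pred_stage {..\<zeta>} (pre x t))))"
  shows "fst (f (pre x (pred_stage {..<\<theta>} (pre x t)))) \<inter>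
      (nbhd - (\<Union>\<zeta>\<in>certified (pre x t) \<inter> {..<\<theta>}. V \<zeta>)) \<times> UNIV
    \<notin> snd (f (pre x (pred_stage {..<\<theta>} (pre x t))))"
  using assms(2)
proof (induction \<theta> rule: less_induct)
  case (less \<theta>)
  let ?K = "certified (pre x t)"
  show ?case
  proof (cases "?K \<inter> {..<\<theta>} = {}")
    case True
    then have p: "pred_stage {..<\<theta>} (pre x t) = t - 1"
      using less.prems by (intro pred_stage_lessThan_eq_pred[OF t]) auto
    have "fst (f (pre x (t - 1))) \<notin> snd (f (pre x (t - 1)))"
      using step_positive[OF step] t by simp
    moreover have "fst (f (pre x (t - 1))) \<inter> nbhd \<times> UNIV = fst (f (pre x (t - 1)))"
      using subset_nbhd[OF t] by blast
    ultimately show ?thesis unfolding p True by simp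
  next
    case False
    define \<delta> where "\<delta> = Max (?K \<inter> {..<\<theta>})"
    have \<delta>: "\<delta> \<in> ?K" "\<delta> < \<theta>" using Max_in[OF _ False] finite_certified by (auto simp: \<delta>_def)
    have max: "\<zeta> \<le> \<delta>" if "\<zeta> \<in> ?K" "\<zeta> < \<theta>" for \<zeta>
      unfolding \<delta>_def using that finite_certified by (intro Max_ge) auto
    have eq: "pred_stage {..<\<theta>} (pre x t) = pred_stage {..\<delta>} (pre x t)"
      using \<delta> less.prems max by (intro pred_stage_lessThan_eq[OF t]) (auto simp: not_le[symmetric])
    have K: "?K \<inter> {..<\<theta>} = insert \<delta> (?K \<inter> {..<\<delta>})"
      using \<delta> max by (auto simp: order_le_less)
    define W where "W = nbhd - (\<Union>\<zeta>\<in>?K \<inter> {..<\<delta>}. V \<zeta>)"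
    define p where "p = pred_stage {..\<delta>} (pre x t)"
    define q where "q = pred_stage {..<\<delta>} (pre x t)"
    have "fst (f (pre x q)) \<inter> W \<times> UNIV \<notin> snd (f (pre x q))"
      using less.IH[OF \<delta>(2)] less.prems \<delta>(2) unfolding W_def q_def by simp
    moreover have "W \<in> G \<delta>"
      unfolding W_def using open_nbhd[OF t] finite_certified V by (intro G_Diff) auto
    moreover have "dominates \<delta> (f (pre x p)) (f (pre x q))"
      unfolding p_def q_def using \<delta>(2) less.prems by (intro dominates_path[OF t]) auto
    ultimately have W: "fst (f (pre x p)) \<inter> W \<times> UNIV \<notin> snd (f (pre x p))"
      by (auto simp: dominates_def)
    have "sigma_ideal (snd (f (pre x p)))"
      using step_ideal[OF step] pred_stage_less[OF t] by (simp add: p_def)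
    moreover have "fst (f (pre x p)) \<inter> V \<delta> \<times> UNIV \<in> snd (f (pre x p))"
      using small[OF \<delta>(1)] by (simp add: p_def)
    ultimately have "fst (f (pre x p)) \<inter> (W - V \<delta>) \<times> UNIV \<notin> snd (f (pre x p))"
      using W sigma_ideal_Un sigma_ideal_subset[where D = "fst (f (pre x p)) \<inter> (W - V \<delta>) \<times> UNIV \<union>
        fst (f (pre x p)) \<inter> V \<delta> \<times> UNIV" and D' = "fst (f (pre x p)) \<inter> W \<times> UNIV"] by blast
    moreover have "W - V \<delta> = nbhd - (\<Union>\<zeta>\<in>?K \<inter> {..<\<theta>}. V \<zeta>)"
      unfolding K W_def by auto
    ultimately show ?thesis unfolding eq p_def by simp
  qed
qed

text \<open>The sets that the domination clauses of \<open>step\<close> force to be negligible at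
  the new label.\<close>

definition small :: "('r \<Rightarrow> baire set) \<Rightarrow> bool" where
  "small V \<longleftrightarrow> (\<forall>\<zeta>\<in>certified (pre x t). V \<zeta> \<in> G \<zeta> \<and>
     fst (f (pre x (pred_stage {..\<zeta>} (pre x t)))) \<inter> V \<zeta> \<times> UNIV \<in> snd (f (pre x (pred_stage {..\<zeta>} (pre x t)))))"

text \<open>The sigma-ideal generated by all that \<open>step\<close> requires to be
  negligible.\<close>

definition new_ideal :: "(baire \<times> baire) set set" where
  "new_ideal = {D. \<exists>H\<in>snd (base f (pre x t)). \<exists>V. small V \<and>
     D \<subseteq> H \<union> (\<Union>\<zeta>\<in>certified (pre x t). V \<zeta>) \<times> UNIV}"

lemma base_cases:
  assumes t: "0 < t"
  obtains "base f (pre x t) = f (pre x (pred_stage {..<rk u} (pre x t)))"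
  | "base f (pre x t) = (C\<^sub>1, {{}})" "\<not> yes (pre x (pred_stage {..<rk u} (pre x t))) u"
  using pred_stage_less[OF t, of "{..<rk u}" x] yes_mono[OF stage_le_pred[OF t], of x u]
  by (cases "yes (pre x t) u = yes (pre x (pred_stage {..<rk u} (pre x t))) u") (auto simp: base_def Let_def)

lemma sigma_ideal_label: "s < t \<Longrightarrow> sigma_ideal (snd (f (pre x s)))"
  using step_ideal[OF step] .

lemma sigma_ideal_base: "0 < t \<Longrightarrow> sigma_ideal (snd (base f (pre x t)))"
proof -
  assume t: "0 < t"
  then show ?thesis
  proof (cases rule: base_cases)
    case 1
    then show ?thesis using sigma_ideal_label pred_stage_less[OF t] by simp
  next
    case 2
    have "sigma_ideal {{} :: (baire \<times> baire) set}" by (auto simp: sigma_ideal_def)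
    then show ?thesis using 2 by simp
  qed
qed

lemma small_empty:
  assumes t: "0 < t"
  shows "small (\<lambda>_. {})"
  using sigma_ideal_empty[OF sigma_ideal_label[OF pred_stage_less[OF t]]] by (simp add: small_def G_open)

lemma small_UN:
  assumes t: "0 < t" and "\<And>n::nat. small (V n)"
  shows "small (\<lambda>\<zeta>. \<Union>n. V n \<zeta>)"
  unfolding small_def
proof (intro ballI conjI)
  fix \<zeta> assume \<zeta>: "\<zeta> \<in> certified (pre x t)"
  show "(\<Union>n. V n \<zeta>) \<in> G \<zeta>" using assms \<zeta> by (intro G_UN) (auto simp: small_def)
  let ?l = "f (pre x (pred_stage {..\<zeta>} (pre x t)))"
  have "(\<Union>n. fst ?l \<inter> V n \<zeta> \<times> UNIV) \<in> snd ?l"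
    using assms \<zeta> pred_stage_less[OF t] by (intro sigma_ideal_UN sigma_ideal_label) (auto simp: small_def)
  moreover have "fst ?l \<inter> (\<Union>n. V n \<zeta>) \<times> UNIV = (\<Union>n. fst ?l \<inter> V n \<zeta> \<times> UNIV)" by auto
  ultimately show "fst ?l \<inter> (\<Union>n. V n \<zeta>) \<times> UNIV \<in> snd ?l" by simp
qed

lemma sigma_ideal_new_ideal:
  assumes t: "0 < t"
  shows "sigma_ideal new_ideal"
proof -
  let ?B = "snd (base f (pre x t))"
  have "{} \<in> new_ideal"
    using sigma_ideal_empty[OF sigma_ideal_base[OF t]] small_empty[OF t] by (auto simp: new_ideal_def)
  moreover have "Pow D \<subseteq> new_ideal" if "D \<in> new_ideal" for D
    using that unfolding new_ideal_def by blast
  moreover have "\<Union>(range F) \<in> new_ideal" if "range F \<subseteq> new_ideal" for F :: "nat \<Rightarrow> _"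
  proof -
    have "\<forall>n. \<exists>H V. H \<in> ?B \<and> small V \<and> F n \<subseteq> H \<union> (\<Union>\<zeta>\<in>certified (pre x t). V \<zeta>) \<times> UNIV"
      using that unfolding new_ideal_def by blast
    then obtain H V where HV: "\<And>n. H n \<in> ?B" "\<And>n. small (V n)"
      "\<And>n. F n \<subseteq> H n \<union> (\<Union>\<zeta>\<in>certified (pre x t). V n \<zeta>) \<times> UNIV" by metis
    have "(\<Union>n. H n) \<in> ?B" using sigma_ideal_base[OF t] HV(1) by (rule sigma_ideal_UN)
    moreover have "\<Union>(range F) \<subseteq> (\<Union>n. H n) \<union> (\<Union>\<zeta>\<in>certified (pre x t). \<Union>n. V n \<zeta>) \<times> UNIV"
      using HV(3) by blast
    ultimately show ?thesis using small_UN[where V = V, OF t HV(2)] unfolding new_ideal_def by blast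
  qed
  ultimately show ?thesis by (simp add: sigma_ideal_def)
qed

text \<open>Removing the small sets leaves \<open>Z\<close>, on which the predecessor below
  \<open>rk u\<close> is still positive by \<open>positive_below\<close>. If its label is the base,
  positivity contradicts the choice of \<open>H\<close>.\<close>

lemma base_positive:
  assumes t: "0 < t"
  shows "fst (base f (pre x t)) \<inter> nbhd \<times> UNIV \<notin> new_ideal"
proof
  let ?K = "certified (pre x t)" and ?p = "pred_stage {..<rk u} (pre x t)"
  assume "fst (base f (pre x t)) \<inter> nbhd \<times> UNIV \<in> new_ideal"
  then obtain H V where HV: "H \<in> snd (base f (pre x t))" "small V"
    "fst (base f (pre x t)) \<inter> nbhd \<times> UNIV \<subseteq> H \<union> (\<Union>\<zeta>\<in>?K. V \<zeta>) \<times> UNIV"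
    by (auto simp: new_ideal_def)
  define Z where "Z = nbhd - (\<Union>\<zeta>\<in>?K. V \<zeta>)"
  have K: "?K \<inter> {..<rk u} = ?K" by (auto simp: certified_def)
  have pos: "fst (f (pre x ?p)) \<inter> Z \<times> UNIV \<notin> snd (f (pre x ?p))"
    using positive_below[OF t order_refl, of V] HV(2) by (auto simp: small_def K Z_def)
  have p: "?p < t" using pred_stage_less[OF t] .
  show False
    using t
  proof (cases rule: base_cases)
    case 1
    then have "fst (f (pre x ?p)) \<inter> Z \<times> UNIV \<subseteq> H" using HV(3) by (auto simp: Z_def)
    then show False using pos HV(1) 1 sigma_ideal_subset[OF sigma_ideal_label[OF p]] by auto
  next
    \<comment> \<open>The guess has switched and \<open>H\<close> is empty, so \<open>Z\<close>
      misses the projection of \<open>C\<^sub>1\<close>. Being in \<open>G (rk u)\<close>, it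
      separates the part of the predecessor over \<open>Z\<close>, which is then negligible
      there.\<close>
    case 2
    then have "C\<^sub>1 \<inter> Z \<times> UNIV = {}" using HV(1,3) by (auto simp: Z_def)
    then have "Z \<inter> fst ` C\<^sub>1 = {}" by auto
    moreover have "Z \<in> G (rk u)"
      unfolding Z_def using open_nbhd[OF t] finite_certified HV(2)
      by (intro G_Diff) (auto simp: small_def certified_def)
    ultimately have "fst (f (pre x ?p)) \<inter> Z \<times> UNIV \<in> root_ideal" by (auto simp: root_ideal_def)
    then show False using pos base_label[OF p] 2(2) by auto
  qed
qed

lemma step_exists:
  assumes t: "0 < t"
  shows "\<exists>l. step f (pre x t) l"
proof -
  let ?B = "fst (base f (pre x t)) \<inter> nbhd \<times> UNIV"
  \<comment> \<open>Cutting by the first \<open>t\<close> digits of value and witness gives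
    countably many pieces, so some piece is positive.\<close>
  define F where "F = (\<lambda>(a, b). {p \<in> ?B. pre (fst p) t = a \<and> pre (snd p) t = b})"
  have "(\<Union>c. F c) = ?B" by (auto simp: F_def)
  then obtain c where c: "F c \<notin> new_ideal"
    using sigma_ideal_UN[OF sigma_ideal_new_ideal[OF t], of F] base_positive[OF t] by auto
  have F: "F c \<subseteq> fst (base f (pre x t))" "F c \<subseteq> nbhd \<times> UNIV" by (auto simp: F_def split: prod.splits)
  have 1: "snd (base f (pre x t)) \<subseteq> new_ideal"
    using small_empty[OF t] by (auto simp: new_ideal_def)
  have 2: "dominates \<theta> (f (pre x (pred_stage {..\<theta>} (pre x t)))) (F c, new_ideal)"
    if "\<theta> \<in> certified (pre x t)" for \<theta>
    unfolding dominates_def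
  proof (intro ballI impI)
    fix V assume V: "V \<in> G \<theta>" "fst (f (pre x (pred_stage {..\<theta>} (pre x t)))) \<inter> V \<times> UNIV
      \<in> snd (f (pre x (pred_stage {..\<theta>} (pre x t))))"
    then have "small ((\<lambda>_. {})(\<theta> := V))" using small_empty[OF t] by (auto simp: small_def)
    moreover have "fst (F c, new_ideal) \<inter> V \<times> UNIV \<subseteq>
        {} \<union> (\<Union>\<zeta>\<in>certified (pre x t). ((\<lambda>_. {})(\<theta> := V)) \<zeta>) \<times> UNIV" using that by auto
    ultimately show "fst (F c, new_ideal) \<inter> V \<times> UNIV \<in> snd (F c, new_ideal)"
      unfolding new_ideal_def snd_conv
      using sigma_ideal_empty[OF sigma_ideal_base[OF t]] by blast
  qed
  have 3: "fst p i = fst q i \<and> snd p i = snd q i" if "p \<in> F c" "q \<in> F c" "i < t" for p q i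
    using that by (auto simp: F_def pre_eq_iff split: prod.splits)
  have 4: "fst p i = fst q i" if "p \<in> F c" "q \<in> fst (f (pre x (t - 1)))" "i < t - 1" for p q i
    using that F(2) by (auto simp: nbhd_def)
  have "step f (pre x t) (F c, new_ideal)"
    by (rule stepI[where l = "(F c, new_ideal)", OF t, unfolded fst_conv snd_conv])
      (fact sigma_ideal_new_ideal[OF t] c F(1) 1 2 3 4)+
  then show ?thesis by blast
qed

end

section \<open>The reduction\<close>

lemma sigma_ideal_root_ideal: "sigma_ideal root_ideal"
proof -
  have "{} \<in> root_ideal" unfolding root_ideal_def by (auto intro!: bexI[of _ "{}"] G_open)
  moreover have "Pow D \<subseteq> root_ideal" if "D \<in> root_ideal" for D
  proof
    fix D' assume "D' \<in> Pow D"
    then have "fst ` D' \<subseteq> fst ` D" by blast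
    then show "D' \<in> root_ideal" using that unfolding root_ideal_def mem_Collect_eq by (meson subset_trans)
  qed
  moreover have "\<Union>(range F) \<in> root_ideal" if "range F \<subseteq> root_ideal" for F :: "nat \<Rightarrow> _"
  proof -
    have "\<forall>n. \<exists>V. V \<in> G (rk u) \<and> fst ` F n \<subseteq> V \<and> V \<inter> fst ` C\<^sub>1 = {}"
    proof
      fix n
      have "F n \<in> root_ideal" using that by auto
      then show "\<exists>V. V \<in> G (rk u) \<and> fst ` F n \<subseteq> V \<and> V \<inter> fst ` C\<^sub>1 = {}"
        unfolding root_ideal_def by blast
    qed
    then obtain V where V: "\<And>n. V n \<in> G (rk u)" "\<And>n. fst ` F n \<subseteq> V n" "\<And>n. V n \<inter> fst ` C\<^sub>1 = {}"
      by metis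
    have "(\<Union>n. V n) \<in> G (rk u)" using V(1) by (rule G_UN)
    moreover have "fst ` \<Union>(range F) \<subseteq> (\<Union>n. V n)" using V(2) by blast
    moreover have "(\<Union>n. V n) \<inter> fst ` C\<^sub>1 = {}" using V(3) by blast
    ultimately show ?thesis unfolding root_ideal_def mem_Collect_eq by (intro bexI conjI)
  qed
  ultimately show ?thesis by (simp add: sigma_ideal_def)
qed

text \<open>Required for choosing the labels by recursion on the length of strings.\<close>

lemma step_cong:
  assumes "\<And>\<rho>. length \<rho> < length \<sigma> \<Longrightarrow> f \<rho> = g \<rho>"
  shows "step f \<sigma> l = step g \<sigma> l"
proof (cases "\<sigma> = []")
  case True
  then show ?thesis by (simp add: step_def)
next
  case False
  \<comment> \<open>Every list is a prefix of a sequence, which makes the lemmas about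
    \<open>pre\<close> applicable; values beyond the end do not matter.\<close>
  have \<sigma>: "\<sigma> = pre ((!) \<sigma>) (length \<sigma>)" by (simp add: list_eq_iff_nth_eq)
  have "pred_stage D \<sigma> < length \<sigma>" for D
    using pred_stage_less[of "length \<sigma>" D "(!) \<sigma>"] False \<sigma> by simp
  then have take: "f (take (pred_stage D \<sigma>) \<sigma>) = g (take (pred_stage D \<sigma>) \<sigma>)" for D
    by (intro assms) simp
  moreover have "f (butlast \<sigma>) = g (butlast \<sigma>)" using False by (intro assms) simp
  moreover have "base f \<sigma> = base g \<sigma>" unfolding base_def Let_def take ..
  ultimately show ?thesis unfolding step_def by simp
qed

lemma labels_exist: "\<exists>f. \<forall>\<sigma>. step f \<sigma> (f \<sigma>)"
proof (rule dependent_wf_choice[of "Wellfounded.measure length"])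
  fix f :: "nat list \<Rightarrow> label" and g \<sigma> l
  assume "\<And>\<rho>. (\<rho>, \<sigma>) \<in> Wellfounded.measure length \<Longrightarrow> f \<rho> = g \<rho>"
  then show "step f \<sigma> l = step g \<sigma> l" by (intro step_cong) simp
next
  fix \<sigma> :: "nat list" and f
  assume f: "\<And>\<rho>. (\<rho>, \<sigma>) \<in> Wellfounded.measure length \<Longrightarrow> step f \<rho> (f \<rho>)"
  show "\<exists>l. step f \<sigma> l"
  proof (cases "\<sigma> = []")
    case True
    have "C\<^sub>0 \<notin> root_ideal" using not_separable by (auto simp: root_ideal_def)
    then have "step f \<sigma> (C\<^sub>0, root_ideal)" using True sigma_ideal_root_ideal by (simp add: step_def)
    then show ?thesis by blast
  next
    case False
    have "\<sigma> = pre ((!) \<sigma>) (length \<sigma>)" by (simp add: list_eq_iff_nth_eq)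
    moreover have "\<exists>l. step f (pre ((!) \<sigma>) (length \<sigma>)) l"
      using f False by (intro step_exists) auto
    ultimately show ?thesis by simp
  qed
qed simp

section \<open>The limit map\<close>

context
  fixes f :: "nat list \<Rightarrow> label"
  assumes step: "\<And>\<sigma>. step f \<sigma> (f \<sigma>)"
begin

abbreviation E :: "baire \<Rightarrow> nat \<Rightarrow> (baire \<times> baire) set" where
  "E x t \<equiv> fst (f (pre x t))"

lemma E_nonempty: "E x t \<noteq> {}"
proof
  assume "E x t = {}"
  then show False using sigma_ideal_empty[OF step_ideal[OF step[of "pre x t"]]]
    step_positive[OF step[of "pre x t"]] by simp
qed

text \<open>Digit \<open>i\<close> comes from the label of length \<open>Suc i\<close>, hence
  depends only on \<open>pre x (Suc i)\<close>; this is continuity.\<close>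

definition reduction :: "baire \<Rightarrow> baire" where
  "reduction x i = fst (SOME p. p \<in> E x (Suc i)) i"

text \<open>Holds at all stages, true or not, since \<open>step\<close> compares each label with the
  one just before.\<close>

lemma reduction_eq: "i < t \<Longrightarrow> p \<in> E x t \<Longrightarrow> fst p i = reduction x i"
proof (induction t arbitrary: p)
  case (Suc t)
  show ?case
  proof (cases "i = t")
    case True
    have "(SOME p. p \<in> E x (Suc i)) \<in> E x (Suc i)" using E_nonempty by (simp add: some_in_eq)
    then show ?thesis using step_agree[OF step Suc.prems(2)] True by (simp add: reduction_def)
  next
    case False
    then have "i < t" using Suc.prems by simp
    obtain q where "q \<in> E x t" using E_nonempty by blast
    then show ?thesis
      using step_agree_pred[OF step Suc.prems(2), of q i] Suc.IH \<open>i < t\<close> by simp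
  qed
qed simp

lemma continuous_reduction: "continuous_on UNIV reduction"
proof (rule continuous_on_coordinatewise_then_product)
  fix i
  have "open ((\<lambda>x. reduction x i) -` S)" for S
  proof (subst open_subopen, intro ballI)
    fix x assume x: "x \<in> (\<lambda>x. reduction x i) -` S"
    have "cyl (pre x (Suc i)) \<subseteq> (\<lambda>x. reduction x i) -` S"
    proof
      fix y assume "y \<in> cyl (pre x (Suc i))"
      then have "pre y (Suc i) = pre x (Suc i)" unfolding pre_eq_iff mem_cyl_pre .
      then have "reduction y i = reduction x i" unfolding reduction_def by (rule arg_cong)
      then show "y \<in> (\<lambda>x. reduction x i) -` S" using x by simp
    qed
    moreover have "x \<in> cyl (pre x (Suc i))" by (simp add: mem_cyl_pre)
    ultimately show "\<exists>T. open T \<and> x \<in> T \<and> T \<subseteq> (\<lambda>x. reduction x i) -` S"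
      using open_cyl by blast
  qed
  then show "continuous_on UNIV (\<lambda>x. reduction x i)"
    using continuous_on_open_vimage[OF open_UNIV, of "\<lambda>x. reduction x i"] by simp
qed

text \<open>The predecessor of \<open>t\<close> below \<open>rk u\<close> is again a true stage, not
  before \<open>s\<close>, with the same guess about \<open>u\<close>; so its label is the base at
  \<open>t\<close>.\<close>

lemma E_antimono:
  assumes "true_stage x {..<rk u} s" "true_stage x {..<rk u} t" "s \<le> t"
    and yes: "\<And>t. true_stage x {..<rk u} t \<Longrightarrow> s \<le> t \<Longrightarrow> yes (pre x t) u = b"
  shows "E x t \<subseteq> E x s"
  using assms(2,3)
proof (induction t rule: less_induct)
  case (less t)
  show ?case
  proof (cases "s = t")
    case False
    let ?p = "pred_stage {..<rk u} (pre x t)"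
    have t: "0 < t" "s < t" using False less.prems by auto
    have p: "?p < t" "stage_le x {..<rk u} ?p t" using pred_stage_less stage_le_pred t(1) by auto
    have "true_stage x {..<rk u} ?p" by (rule true_stage_downward[OF p(2) less.prems(1)]) auto
    moreover have "stage_le x {..<rk u} s t" by (rule true_stage_imp_le[OF assms(1) less.prems]) auto
    then have "s \<le> ?p" using pred_stage_greatest t by auto
    ultimately have "E x ?p \<subseteq> E x s" "yes (pre x t) u = yes (pre x ?p) u"
      using less p(1) yes by auto
    moreover have "E x t \<subseteq> fst (base f (pre x t))" using step_base(1)[OF step t(1)] .
    ultimately show ?thesis using p(1) by (auto simp: base_def Let_def)
  qed simp
qed

text \<open>The labels at true stages past \<open>s\<close> decrease inside \<open>C\<close> and fix
  ever more digits of value and witness; \<open>C\<close> being closed contains the limit.\<close>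

lemma limit_in_closed:
  assumes C: "closed C" and b: "\<And>t. true_stage x {..<rk u} t \<Longrightarrow> s \<le> t \<Longrightarrow> yes (pre x t) u = b \<and> E x t \<subseteq> C"
  shows "reduction x \<in> fst ` C"
proof -
  have "infinite {t. true_stage x {..<rk u} t}" by (intro infinite_true_stage_lessThan infinite_true_stage)
  then have inf: "\<exists>t>n. true_stage x {..<rk u} t" for n
    unfolding infinite_nat_iff_unbounded by blast
  have "\<exists>t. i < t \<and> s \<le> t \<and> true_stage x {..<rk u} t" for i
    using inf[of "max i s"] by auto
  then obtain n where n: "\<And>i. i < n i \<and> s \<le> n i \<and> true_stage x {..<rk u} (n i)" by metis
  have "\<exists>p. p \<in> E x (n i)" for i using E_nonempty by blast
  then obtain q where q: "\<And>i. q i \<in> E x (n i)" by metis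
  \<comment> \<open>The limit witness: digit \<open>i\<close> is read at a true stage beyond
    \<open>i\<close>, where all members of the label share it.\<close>
  define z where "z i = snd (q i) i" for i
  have z: "snd p i = z i" if t: "true_stage x {..<rk u} t" "s \<le> t" "i < t" "p \<in> E x t" for t p i
  proof (cases "t \<le> n i")
    case True
    have "E x (n i) \<subseteq> E x t"
      using n t(1) True b order.trans[OF t(2)] by (intro E_antimono[where b = b]) blast+
    then show ?thesis using step_agree[OF step t(4), of "q i" i] q[of i] t(3) by (auto simp: z_def)
  next
    case False
    have "E x t \<subseteq> E x (n i)"
      using n t(1) False b by (intro E_antimono[where b = b]) (blast, blast, simp, meson order.trans)
    then show ?thesis using step_agree[OF step q[of i], of p i] n[of i] t(4) by (auto simp: z_def)
  qed
  have "(reduction x, z) \<in> C"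
  proof (rule ccontr)
    assume "(reduction x, z) \<notin> C"
    moreover have "open (- C)" using C by (rule open_Compl)
    ultimately obtain A B where AB: "open A" "open B" "(reduction x, z) \<in> A \<times> B" "A \<times> B \<subseteq> - C"
      by (metis ComplI open_prod_def)
    then obtain k m where km: "cyl (pre (reduction x) k) \<subseteq> A" "cyl (pre z m) \<subseteq> B"
      using open_contains_cyl by (metis mem_Sigma_iff)
    obtain t where t: "t > max s (max k m)" "true_stage x {..<rk u} t" using inf by blast
    obtain p where p: "p \<in> E x t" using E_nonempty by blast
    have "fst p \<in> cyl (pre (reduction x) k)" using reduction_eq[OF _ p] t(1) by (auto simp: mem_cyl_pre)
    moreover have "snd p \<in> cyl (pre z m)" using z[OF t(2) _ _ p] t(1) by (auto simp: mem_cyl_pre)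
    ultimately have "p \<in> A \<times> B" using km by (auto simp: mem_Times_iff)
    moreover have "p \<in> C" using b[OF t(2)] t(1) p by auto
    ultimately show False using AB(4) by auto
  qed
  then show ?thesis by force
qed

text \<open>At stages true below \<open>rk u\<close> a yes guess about \<open>u\<close> is right,
  and if \<open>x\<close> is in the set, yes is guessed from some point on.\<close>

lemma reduction_correct:
  assumes "closed C\<^sub>0" "closed C\<^sub>1"
  shows "reduction x \<in> fst ` (if x \<in> nset u then C\<^sub>1 else C\<^sub>0)"
proof -
  obtain s where s: "\<And>t. true_stage x {..<rk u} t \<Longrightarrow> s \<le> t \<Longrightarrow> yes (pre x t) u \<longleftrightarrow> x \<in> nset u"
    using yes_eventually[OF infinite_true_stage, of x u] yes_true_stage[of x u] by (cases "x \<in> nset u") blast+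
  have E: "E x t \<subseteq> (if yes (pre x t) u then C\<^sub>1 else C\<^sub>0)" for t
    using base_label[where f = f and t = "Suc t" and s = t, OF step] by (auto split: if_splits)
  have "yes (pre x t) u = (x \<in> nset u) \<and> E x t \<subseteq> (if x \<in> nset u then C\<^sub>1 else C\<^sub>0)"
    if "true_stage x {..<rk u} t" "s \<le> t" for t
    using s[OF that] E[of t] by (cases "x \<in> nset u") simp_all
  then show ?thesis by (rule limit_in_closed[rotated]) (simp_all add: assms)
qed

end

theorem reduction_exists:
  assumes "closed C\<^sub>0" "closed C\<^sub>1"
  shows "\<exists>g :: baire \<Rightarrow> baire. continuous_on UNIV g \<and>
    (\<forall>x. g x \<in> fst ` (if x \<in> nset u then C\<^sub>1 else C\<^sub>0))"
proof -
  obtain f where "\<And>\<sigma>. step f \<sigma> (f \<sigma>)" using labels_exist by blast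
  then show ?thesis using continuous_reduction reduction_correct[OF _ assms] by blast
qed

end

section \<open>Countable ordinals and Borel classes\<close>

quotient_type cord = "nat rel" / partial: "\<lambda>r s. (r, s) \<in> ordIso"
proof (rule part_equivpI)
  show "\<exists>r::nat rel. (r, r) \<in> ordIso"
    using ordIso_reflexive[of "{} :: nat rel"] by auto
qed (auto intro!: sympI transpI intro: ordIso_symmetric ordIso_transitive)

lemma Well_order_rep_cord: "Well_order (rep_cord \<alpha>)"
  using Quotient_rep_reflp[OF Quotient_cord, of \<alpha>] by (simp add: ordIso_def)

lemma rep_abs_cord: "Well_order r \<Longrightarrow> (rep_cord (abs_cord r), r) \<in> ordIso"
  using Quotient_rep_abs[OF Quotient_cord] ordIso_reflexive by metis

lemma rep_cord_inject: "(rep_cord \<alpha>, rep_cord \<beta>) \<in> ordIso \<Longrightarrow> \<alpha> = \<beta>"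
  using Quotient_rel_rep[OF Quotient_cord] by metis

instantiation cord :: wellorder
begin

definition less_eq_cord :: "cord \<Rightarrow> cord \<Rightarrow> bool" where
  "\<alpha> \<le> \<beta> \<longleftrightarrow> (rep_cord \<alpha>, rep_cord \<beta>) \<in> ordLeq"

definition less_cord :: "cord \<Rightarrow> cord \<Rightarrow> bool" where
  "\<alpha> < \<beta> \<longleftrightarrow> (rep_cord \<alpha>, rep_cord \<beta>) \<in> ordLess"

instance
proof
  fix \<alpha> \<beta> \<gamma> :: cord
  note wo = Well_order_rep_cord[of \<alpha>] Well_order_rep_cord[of \<beta>]
  show "\<alpha> < \<beta> \<longleftrightarrow> \<alpha> \<le> \<beta> \<and> \<not> \<beta> \<le> \<alpha>"
    using ordLeq_total[OF wo] not_ordLeq_iff_ordLess[OF wo]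
    by (auto simp: less_eq_cord_def less_cord_def)
  show "\<alpha> \<le> \<alpha>" using ordLeq_reflexive[OF wo(1)] by (simp add: less_eq_cord_def)
  show "\<alpha> \<le> \<gamma>" if "\<alpha> \<le> \<beta>" "\<beta> \<le> \<gamma>"
    using that ordLeq_transitive by (auto simp: less_eq_cord_def)
  show "\<alpha> = \<beta>" if "\<alpha> \<le> \<beta>" "\<beta> \<le> \<alpha>"
    using that ordIso_iff_ordLeq by (intro rep_cord_inject) (auto simp: less_eq_cord_def)
  show "\<alpha> \<le> \<beta> \<or> \<beta> \<le> \<alpha>" using ordLeq_total[OF wo] by (simp add: less_eq_cord_def)
next
  fix P :: "cord \<Rightarrow> bool" and \<alpha>
  assume step: "\<And>\<alpha>. (\<And>\<beta>. \<beta> < \<alpha> \<Longrightarrow> P \<beta>) \<Longrightarrow> P \<alpha>"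
  have "wf (inv_image ordLess rep_cord)" using wf_ordLess by (rule wf_inv_image)
  then show "P \<alpha>"
    by (induction \<alpha> rule: wf_induct_rule) (auto intro: step simp: less_cord_def)
qed

end

lemma ordLess_abs_cord:
  assumes "(r, s) \<in> ordLess" "Well_order r" "Well_order s"
  shows "abs_cord r < abs_cord s"
  unfolding less_cord_def
  using ordIso_ordLess_trans[OF rep_abs_cord[OF assms(2)] ordLess_ordIso_trans[OF assms(1)]]
    ordIso_symmetric[OF rep_abs_cord[OF assms(3)]] by blast

lemma ordLeq_empty: "(r, {} :: 'a rel) \<in> ordLeq \<Longrightarrow> r = {}"
proof -
  assume "(r, {} :: 'a rel) \<in> ordLeq"
  then obtain f where "Well_order r" "embed r ({} :: 'a rel) f" by (auto simp: ordLeq_def)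
  then have "f ` Field r \<subseteq> Field ({} :: 'a rel)" by (intro embed_Field)
  then show "r = {}" by (auto simp: Field_def)
qed

lemma empty_ordLess:
  assumes "Well_order r" "r \<noteq> {}"
  shows "({} :: 'a rel, r) \<in> ordLess"
proof -
  have "Well_order ({} :: 'a rel)" by simp
  then show ?thesis using ordLess_or_ordLeq[OF _ assms(1)] ordLeq_empty assms(2) by blast
qed

section \<open>Closure properties of the Borel classes\<close>

lemma Sigma0_empty_iff: "Sigma0_one_plus {} A \<longleftrightarrow> open A"
proof
  assume "Sigma0_one_plus {} A"
  then show "open A"
  proof cases
    case (countable_union \<eta> B)
    then have "(\<eta> 0, {} :: nat rel) \<in> ordLeq"
      using ordLess_imp_ordLeq by blast
    then have "\<eta> 0 = {}" by (rule ordLeq_empty)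
    then show ?thesis using countable_union(2)[of 0] ordLess_irreflexive by metis
  qed simp
qed (rule open_sets)

lemma Sigma0_ordIso:
  assumes "Sigma0_one_plus r A" "(r, s) \<in> ordIso"
  shows "Sigma0_one_plus s A"
  using assms(1)
proof cases
  case open_sets
  then have "s = {}" using assms(2) ordIso_symmetric ordIso_iff_ordLeq ordLeq_empty by metis
  then show ?thesis using open_sets by (simp add: Sigma0_empty_iff)
next
  case (countable_union \<eta> B)
  then show ?thesis using assms(2) ordLess_ordIso_trans
    by (metis Sigma0_one_plus.countable_union)
qed

lemma Sigma0_Compl:
  assumes "Sigma0_one_plus r V" "(r, s) \<in> ordLess"
  shows "Sigma0_one_plus s (- V)"
proof -
  have "Sigma0_one_plus s (\<Union>n::nat. - V)"
    using assms by (intro countable_union[where \<eta> = "\<lambda>_. r"]) auto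
  then show ?thesis by simp
qed

text \<open>An open set is a countable union of cylinders, and these are clopen.\<close>

lemma Sigma0_open:
  assumes "Well_order r" "open V"
  shows "Sigma0_one_plus r V"
proof (cases "r = {}")
  case True
  then show ?thesis using assms(2) by (simp add: Sigma0_empty_iff)
next
  case False
  define B where "B n = (let \<sigma> = from_nat n in if cyl \<sigma> \<subseteq> V then cyl \<sigma> else {})" for n :: nat
  have "V \<subseteq> (\<Union>n. B n)"
  proof
    fix x assume "x \<in> V"
    then obtain k where "cyl (pre x k) \<subseteq> V" using open_contains_cyl assms(2) by blast
    then have "x \<in> B (to_nat (pre x k))" by (simp add: B_def mem_cyl_pre)
    then show "x \<in> (\<Union>n. B n)" by blast
  qed
  moreover have "(\<Union>n. B n) \<subseteq> V" by (auto simp: B_def Let_def split: if_splits)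
  ultimately have "V = (\<Union>n. B n)" by blast
  moreover have "open (- B n)" for n using open_Compl[OF closed_cyl] by (simp add: B_def Let_def)
  then have "Sigma0_one_plus r (\<Union>n. B n)"
    using empty_ordLess[OF assms(1) False]
    by (intro countable_union[where \<eta> = "\<lambda>_. {}"]) (simp_all add: Sigma0_empty_iff)
  ultimately show ?thesis by simp
qed

lemma Sigma0_cases:
  assumes "Sigma0_one_plus r A"
  shows "(r = {} \<and> open A) \<or> (\<exists>\<eta> B. A = (\<Union>n::nat. - B n) \<and>
    (\<forall>n. (\<eta> n, r) \<in> ordLess \<and> Sigma0_one_plus (\<eta> n) (B n)))"
  using assms
proof cases
  case (countable_union \<eta> B)
  then show ?thesis by (intro disjI2 exI[of _ \<eta>] exI[of _ "\<lambda>n. - B n"]) simp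
qed simp

lemma Sigma0_mono:
  assumes "Sigma0_one_plus r A" "(r, s) \<in> ordLess"
  shows "Sigma0_one_plus s A"
  using Sigma0_cases[OF assms(1)]
proof
  assume "r = {} \<and> open A"
  then show ?thesis using assms(2) by (intro Sigma0_open) (auto simp: ordLess_def)
next
  assume "\<exists>\<eta> B. A = (\<Union>n::nat. - B n) \<and>
    (\<forall>n. (\<eta> n, r) \<in> ordLess \<and> Sigma0_one_plus (\<eta> n) (B n))"
  then obtain \<eta> B where B: "A = (\<Union>n::nat. - B n)" "\<And>n. (\<eta> n, r) \<in> ordLess"
    "\<And>n. Sigma0_one_plus (\<eta> n) (B n)" by blast
  have "(\<eta> n, s) \<in> ordLess" for n using B(2) assms(2) by (rule ordLess_transitive)
  then show ?thesis unfolding B(1) by (rule countable_union[where \<eta> = \<eta>]) (simp_all add: B(3))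
qed

lemma Sigma0_UN:
  assumes "\<And>n::nat. Sigma0_one_plus r (A n)"
  shows "Sigma0_one_plus r (\<Union>n. A n)"
proof (cases "r = {}")
  case True
  then show ?thesis using assms by (auto simp: Sigma0_empty_iff)
next
  case False
  have "\<forall>n. \<exists>\<eta> B. A n = (\<Union>m::nat. - B m) \<and>
      (\<forall>m. (\<eta> m, r) \<in> ordLess \<and> Sigma0_one_plus (\<eta> m) (B m))"
  proof
    fix n
    show "\<exists>\<eta> B. A n = (\<Union>m::nat. - B m) \<and>
        (\<forall>m. (\<eta> m, r) \<in> ordLess \<and> Sigma0_one_plus (\<eta> m) (B m))"
      using Sigma0_cases[OF assms[of n]] False by simp
  qed
  then obtain \<eta> B where B: "\<And>n. A n = (\<Union>m::nat. - B n m)" "\<And>n m. (\<eta> n m, r) \<in> ordLess"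
    "\<And>n m. Sigma0_one_plus (\<eta> n m) (B n m)" by metis
  define d where "d k = (from_nat k :: nat \<times> nat)" for k
  have "Sigma0_one_plus r (\<Union>k::nat. - B (fst (d k)) (snd (d k)))"
    using B(2,3) by (intro countable_union[where \<eta> = "\<lambda>k. \<eta> (fst (d k)) (snd (d k))"]) simp_all
  moreover have "(\<Union>k::nat. - B (fst (d k)) (snd (d k))) = (\<Union>n. A n)"
  proof (intro equalityI subsetI)
    fix x assume "x \<in> (\<Union>n. A n)"
    then obtain n m where "x \<in> - B n m" using B(1) by auto
    then have "x \<in> - B (fst (d (to_nat (n, m)))) (snd (d (to_nat (n, m))))" by (simp add: d_def)
    then show "x \<in> (\<Union>k::nat. - B (fst (d k)) (snd (d k)))" by blast
  qed (use B(1) in auto)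
  ultimately show ?thesis by simp
qed

text \<open>The derivation of \<open>A\<close> is unfolded into a tree indexed by finite sequences,
  which are then coded by numbers.\<close>

lemma node_family_exists:
  assumes "Well_order \<xi>" "Sigma0_one_plus \<xi> A"
  obtains nset :: "nat \<Rightarrow> baire set" and rk :: "nat \<Rightarrow> cord" and ch u
  where "node_family nset rk ch" "nset u = A" "rk u = abs_cord \<xi>"
proof -
  have "\<exists>\<eta> B. \<not> open (snd p) \<longrightarrow> Sigma0_one_plus (fst p) (snd p) \<longrightarrow>
      snd p = (\<Union>n::nat. - B n) \<and> (\<forall>n. (\<eta> n, fst p) \<in> ordLess \<and> Sigma0_one_plus (\<eta> n) (B n))"
    for p using Sigma0_cases[of "fst p" "snd p"] by blast
  then obtain \<eta> B where B: "\<And>p. \<not> open (snd p) \<Longrightarrow> Sigma0_one_plus (fst p) (snd p) \<Longrightarrow>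
      snd p = (\<Union>n::nat. - B p n) \<and>
      (\<forall>n. (\<eta> p n, fst p) \<in> ordLess \<and> Sigma0_one_plus (\<eta> p n) (B p n))"
    by metis
  \<comment> \<open>The empty sequence carries \<open>A\<close>, and \<open>n # \<sigma>\<close>
    carries the \<open>n\<close>-th set in the union for \<sigma>; below an open set the pair is
    merely repeated.\<close>
  define nd where "nd = rec_list (\<xi>, A) (\<lambda>n _ p. if open (snd p) then p else (\<eta> p n, B p n))"
  have nd: "nd [] = (\<xi>, A)"
    "nd (n # \<sigma>) = (if open (snd (nd \<sigma>)) then nd \<sigma> else (\<eta> (nd \<sigma>) n, B (nd \<sigma>) n))" for n \<sigma>
    by (simp_all add: nd_def)
  have inv: "Well_order (fst (nd \<sigma>)) \<and> Sigma0_one_plus (fst (nd \<sigma>)) (snd (nd \<sigma>))" for \<sigma>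
  proof (induction \<sigma>)
    case Nil
    then show ?case using assms by (simp add: nd)
  next
    case (Cons n \<sigma>)
    then show ?case using B[of "nd \<sigma>"] by (auto simp: nd ordLess_def)
  qed
  define ch where "ch w = range (\<lambda>n. to_nat (n # from_nat w :: nat list))" for w :: nat
  have "node_family (\<lambda>w. snd (nd (from_nat w))) (\<lambda>w. abs_cord (fst (nd (from_nat w)))) ch"
  proof
    fix w :: nat
    let ?p = "nd (from_nat w)"
    show "open (snd ?p) \<or> snd ?p = (\<Union>v\<in>ch w. - snd (nd (from_nat v))) \<and>
      (\<forall>v\<in>ch w. abs_cord (fst (nd (from_nat v))) < abs_cord (fst ?p))"
    proof (cases "open (snd ?p)")
      case False
      have "snd ?p = (\<Union>n::nat. - B ?p n)" "\<And>n. (\<eta> ?p n, fst ?p) \<in> ordLess"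
        using B[OF False] inv[of "from_nat w"] by blast+
      moreover have "abs_cord (\<eta> ?p n) < abs_cord (fst ?p)" for n
        using calculation(2)[of n] by (intro ordLess_abs_cord) (auto simp: ordLess_def)
      moreover have "nd (from_nat (to_nat (n # from_nat w :: nat list))) = (\<eta> ?p n, B ?p n)" for n
        using False by (simp add: nd)
      ultimately show ?thesis unfolding ch_def by simp
    qed simp
  qed
  then show ?thesis by (rule that[of _ _ _ "to_nat ([] :: nat list)"]) (simp_all add: nd)
qed

section \<open>The dichotomy\<close>

theorem theorem4p1:
  fixes \<xi> :: "nat rel" and A B\<^sub>0 B\<^sub>1 :: "baire set"
  assumes "Well_order \<xi>"
    and "Sigma0_one_plus \<xi> A"
    and "Sigma11 B\<^sub>0" and "Sigma11 B\<^sub>1" and "B\<^sub>0 \<inter> B\<^sub>1 = {}"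
  shows "(\<exists>f :: baire \<Rightarrow> baire. continuous_on UNIV f \<and> A = f -` B\<^sub>1 \<and> UNIV - A = f -` B\<^sub>0)
    \<or> (\<exists>U. Sigma0_one_plus \<xi> U \<and> B\<^sub>0 \<subseteq> U \<and> B\<^sub>1 \<inter> U = {})"
proof (rule disjCI)
  assume nosep: "\<not> (\<exists>U. Sigma0_one_plus \<xi> U \<and> B\<^sub>0 \<subseteq> U \<and> B\<^sub>1 \<inter> U = {})"
  have "\<exists>C :: (baire \<times> baire) set. closed C \<and> B = fst ` C" if "Sigma11 B" for B
    using that unfolding Sigma11_def by (force simp: image_iff)
  then obtain C\<^sub>0 C\<^sub>1 :: "(baire \<times> baire) set"
    where C: "closed C\<^sub>0" "closed C\<^sub>1" "B\<^sub>0 = fst ` C\<^sub>0" "B\<^sub>1 = fst ` C\<^sub>1"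
    using assms(3,4) by metis
  obtain nset :: "nat \<Rightarrow> baire set" and rk :: "nat \<Rightarrow> cord" and ch u
    where nodes: "node_family nset rk ch" and u: "nset u = A" "rk u = abs_cord \<xi>"
    using node_family_exists[OF assms(1,2)] .
  define G where "G \<theta> = {V. Sigma0_one_plus (rep_cord \<theta>) V}" for \<theta>
  interpret node_family nset rk ch by (rule nodes)
  interpret separation nset rk ch G u C\<^sub>0 C\<^sub>1
  proof
    show "V \<in> G \<theta>" if "open V" for V \<theta>
      using Sigma0_open[OF Well_order_rep_cord that] by (simp add: G_def)
    show "(\<Union>n. F n) \<in> G \<theta>" if "\<And>n::nat. F n \<in> G \<theta>" for F \<theta>
      using that Sigma0_UN unfolding G_def by blast
    show "V \<in> G \<theta>'" if "V \<in> G \<theta>" "\<theta> \<le> \<theta>'" for V \<theta> \<theta>'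
      using that Sigma0_mono unfolding G_def order_le_less less_cord_def by blast
    show "- V \<in> G \<theta>'" if "V \<in> G \<theta>" "\<theta> < \<theta>'" for V \<theta> \<theta>'
      using that Sigma0_Compl unfolding G_def less_cord_def by blast
    show "V \<inter> fst ` C\<^sub>1 \<noteq> {}" if "V \<in> G (rk u)" "fst ` C\<^sub>0 \<subseteq> V" for V
    proof -
      \<comment> \<open>\<open>G (rk u)\<close> is formed with the chosen representative of the
        class of \<xi>, which is only isomorphic to \<xi>.\<close>
      have "Sigma0_one_plus \<xi> V"
        using that(1) Sigma0_ordIso[OF _ rep_abs_cord[OF assms(1)]] by (simp add: G_def u)
      then show ?thesis using nosep that(2) C by blast
    qed
  qed
  obtain g :: "baire \<Rightarrow> baire" where g: "continuous_on UNIV g"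
    "\<And>x. g x \<in> fst ` (if x \<in> A then C\<^sub>1 else C\<^sub>0)"
    using reduction_exists[OF C(1,2)] u(1) by auto
  have "g x \<in> (if x \<in> A then B\<^sub>1 else B\<^sub>0)" for x using g(2)[of x] C by (simp split: if_splits)
  then have "A = g -` B\<^sub>1 \<and> UNIV - A = g -` B\<^sub>0"
    using assms(5) by (auto split: if_splits) (metis disjoint_iff)+
  then show "\<exists>f :: baire \<Rightarrow> baire. continuous_on UNIV f \<and> A = f -` B\<^sub>1 \<and> UNIV - A = f -` B\<^sub>0"
    using g(1) by blast
qed

end
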